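(* Let $k\ge 3$ be an integer and let $G$ be a connected $d$-regular graph with edge connectivity $\kappa'$. Let $l=d-(k-2)\kappa'$. Then each of the following statements holds. (i) If $l\le 0$, then $G$ has a spanning $k$-tree. (ii) If $l>0$ and \[ \lambda_{\left\lceil\frac{3d}{l}\right\rceil}(G) < d-\frac{d}{(k-2)(d+1)}, \] then $G$ has a spanning $k$-tree.
   Context: All graphs are finite, undirected and simple. For a graph $G$ of order $n$, $\lambda_1(G)\ge\lambda_2(G)\ge\dots\ge\lambda_n(G)$ denote the eigenvalues of its adjacency matrix (with multiplicity). The edge connectivity of $G$ is denoted $\kappa'=\kappa'(G)$. For an integer $k\ge 2$, a $k$-tree is a tree with maximum degree at most $k$; a spanning $k$-tree of $G$ is a spanning tree of $G$ that is a $k$-tree. *)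

theory Defs
  imports
    Complex_Main
    "HOL-Library.Multiset"
    "Graph_Theory.Graph_Theory"
    "Jordan_Normal_Form.Char_Poly"
begin

text \<open>
  A finite simple undirected graph is a \<^locale>\<open>pair_graph\<close>: a finite vertex set with a finite,
  symmetric and irreflexive set of arcs, so that every undirected edge is represented by the two
  arcs joining its ends. Consequently the degree of a vertex is its out-degree.
\<close>

definition regular_graph :: "nat \<Rightarrow> 'a pair_pre_digraph \<Rightarrow> bool" where
  "regular_graph d G \<longleftrightarrow> (\<forall>v \<in> pverts G. out_degree (with_proj G) v = d)"

definition undirected_edges :: "'a pair_pre_digraph \<Rightarrow> 'a set set" where
  "undirected_edges G = {{u, v} | u v. (u, v) \<in> parcs G}"

definition delete_edges :: "'a pair_pre_digraph \<Rightarrow> 'a set set \<Rightarrow> 'a pair_pre_digraph" where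
  "delete_edges G F = G\<lparr>parcs := {(u, v). (u, v) \<in> parcs G \<and> {u, v} \<notin> F}\<rparr>"

text \<open>
  The least number of edges whose deletion disconnects the graph. The one-vertex graph cannot be
  disconnected; its edge connectivity is 0 by convention.
\<close>

definition edge_connectivity :: "'a pair_pre_digraph \<Rightarrow> nat" where
  "edge_connectivity G =
     (if card (pverts G) \<le> 1 then 0
      else (LEAST c. \<exists>F \<subseteq> undirected_edges G.
              card F = c \<and> \<not> connected (with_proj (delete_edges G F))))"

text \<open>
  The library predicate \<^const>\<open>tree\<close> is not usable for symmetric digraphs, since it counts a walk
  back and forth along a single edge as a cycle. In a simple graph, the closed walks without repeated
  vertices of length at least 3 are exactly the cycles in the undirected sense.
\<close>

definition undirected_tree :: "'a pair_pre_digraph \<Rightarrow> bool" where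
  "undirected_tree T \<longleftrightarrow>
     pair_graph T \<and> connected (with_proj T) \<and> \<not> (\<exists>p. pre_digraph.cycle (with_proj T) p \<and> 3 \<le> length p)"

definition k_tree :: "nat \<Rightarrow> 'a pair_pre_digraph \<Rightarrow> bool" where
  "k_tree k T \<longleftrightarrow> undirected_tree T \<and> (\<forall>v \<in> pverts T. out_degree (with_proj T) v \<le> k)"

definition has_spanning_k_tree :: "nat \<Rightarrow> 'a pair_pre_digraph \<Rightarrow> bool" where
  "has_spanning_k_tree k G \<longleftrightarrow> (\<exists>T :: 'a pair_pre_digraph. spanning (with_proj T) (with_proj G) \<and> k_tree k T)"

text \<open>
  The adjacency matrix depends on an enumeration of the vertices, but its characteristic polynomial
  does not, so the spectrum is defined through an arbitrarily chosen enumeration.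
\<close>

definition vertex_enum :: "'a pair_pre_digraph \<Rightarrow> 'a list" where
  "vertex_enum G = (SOME vs. distinct vs \<and> set vs = pverts G)"

definition adjacency_matrix :: "'a pair_pre_digraph \<Rightarrow> real mat" where
  "adjacency_matrix G =
     (let vs = vertex_enum G; n = card (pverts G)
      in mat n n (\<lambda>(i, j). if (vs ! i, vs ! j) \<in> parcs G then 1 else 0))"

text \<open>
  \<open>graph_eigenvalue G i\<close> is the \<open>i\<close>-th largest eigenvalue, counted from 1 and with multiplicity. The
  adjacency matrix is real symmetric, so its characteristic polynomial has as many real roots as
  there are vertices. The value is meaningful only for \<open>i\<close> between 1 and the number of vertices.
\<close>

definition graph_eigenvalues :: "'a pair_pre_digraph \<Rightarrow> real list" where
  "graph_eigenvalues G = rev (sorted_list_of_multiset (proots (char_poly (adjacency_matrix G))))"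

definition graph_eigenvalue :: "'a pair_pre_digraph \<Rightarrow> nat \<Rightarrow> real" where
  "graph_eigenvalue G i = graph_eigenvalues G ! (i - 1)"

end

theory Submission
  imports Defs "Jordan_Normal_Form.Spectral_Radius"
begin

text \<open>
  The proof combines a toughness condition for spanning \<open>k\<close>-trees with eigenvalue interlacing.

  Win's theorem (lemma \<open>spanning_tree_of_bounded_degree\<close>) says: if deleting any nonempty vertex set
  \<open>S\<close> from a connected graph leaves at most \<open>(k - 2)|S| + 2\<close> components, then there is a spanning tree
  of maximum degree at most \<open>k\<close>. Take a spanning tree \<open>T\<close> whose total excess of degrees over \<open>k\<close> is
  minimal, and start from the set \<open>S\<close> of vertices of degree at least \<open>k\<close> in \<open>T\<close>. An edge of the graph
  between two components of \<open>T - S\<close> closes a cycle through \<open>S\<close>; exchanging it for a tree edge at a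
  vertex \<open>x\<close> of \<open>S\<close> on that cycle lowers the degree of \<open>x\<close>. If \<open>x\<close> had degree above \<open>k\<close> this
  contradicts minimality, and otherwise \<open>x\<close> can be brought below degree \<open>k\<close> whenever needed, so \<open>x\<close> may
  leave \<open>S\<close> (\<open>release_step\<close>). When no vertex can leave any more, the graph and the tree have the same
  components outside \<open>S\<close>. A tree has at least \<open>(\<Sum>v\<in>S. deg v - 2) + 2\<close> such components, and this exceeds
  \<open>(k - 2)|S| + 2\<close> if some degree exceeds \<open>k\<close>.

  If the \<open>d\<close>-regular graph has no spanning \<open>k\<close>-tree, there is thus a set \<open>S\<close> with at least
  \<open>(k - 2)|S| + 3\<close> components outside it. Each component sends at least \<open>\<kappa>'\<close> edges to \<open>S\<close>, and all of them
  together send at most \<open>d|S|\<close>. Hence the number \<open>r\<close> of components that send fewer than \<open>d/(k - 2)\<close>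
  edges satisfies \<open>r l \<ge> 3 d\<close> with \<open>d > 0\<close> (\<open>many_components_with_few_leaving\<close>). This forces \<open>l > 0\<close>,
  which is statement (i), and \<open>r \<ge> 3 d / l\<close>. Each of these \<open>r\<close> components has at least \<open>d + 1\<close>
  vertices, because fewer than \<open>d\<close> edges leave it, and so its average degree is at least
  \<open>d - d / ((k - 2)(d + 1))\<close>. The components are pairwise nonadjacent, so their indicator vectors span an
  \<open>r\<close>-dimensional space on which the quadratic form of the adjacency matrix is at least that number
  times the squared norm, and the \<open>r\<close> largest eigenvalues are at least that number
  (\<open>graph_eigenvalue_ge\<close>). This is statement (ii).
\<close>

section \<open>Components and forests given by edge sets\<close>

definition pairs_on :: "'a set \<Rightarrow> 'a set set" where
  "pairs_on W = {{a, b} | a b. a \<in> W \<and> b \<in> W \<and> a \<noteq> b}"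

text \<open>
  Undirected edges are two-element sets. Reachability along them is automatically an equivalence
  relation, and a vertex that lies on no edge forms a class of its own.
\<close>

definition reach :: "'a set set \<Rightarrow> ('a \<times> 'a) set" where
  "reach F = {(a, b). {a, b} \<in> F}\<^sup>*"

definition joins :: "'a set set \<Rightarrow> 'a set \<Rightarrow> bool" where
  "joins F W \<longleftrightarrow> (\<forall>a\<in>W. \<forall>b\<in>W. (a, b) \<in> reach F)"

definition comps :: "'a set set \<Rightarrow> 'a set \<Rightarrow> 'a set set" where
  "comps F W = (\<lambda>v. reach F `` {v}) ` W"

text \<open>
  An edge set is acyclic exactly if the ends of each edge fall apart once that edge is removed; this
  form is the one that exchange arguments use.
\<close>

definition forest_edges :: "'a set set \<Rightarrow> bool" where
  "forest_edges F \<longleftrightarrow> (\<forall>a b. a \<noteq> b \<longrightarrow> {a, b} \<in> F \<longrightarrow> (a, b) \<notin> reach (F - {{a, b}}))"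

definition avoid :: "'a set set \<Rightarrow> 'a set \<Rightarrow> 'a set set" where
  "avoid F S = {e \<in> F. e \<inter> S = {}}"

definition inside :: "'a set set \<Rightarrow> 'a set \<Rightarrow> 'a set set" where
  "inside F C = {e \<in> F. e \<subseteq> C}"

definition edge_degree :: "'a set set \<Rightarrow> 'a \<Rightarrow> nat" where
  "edge_degree F v = card {e \<in> F. v \<in> e}"

lemma reach_refl [simp]: "(a, a) \<in> reach F"
  by (simp add: reach_def)

lemma reach_trans: "(a, b) \<in> reach F \<Longrightarrow> (b, c) \<in> reach F \<Longrightarrow> (a, c) \<in> reach F"
  unfolding reach_def by (rule rtrancl_trans)

lemma reach_sym: "(a, b) \<in> reach F \<Longrightarrow> (b, a) \<in> reach F"
proof -
  have "sym {(a, b). {a, b} \<in> F}" by (auto simp: sym_def insert_commute)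
  then have "sym (reach F)" unfolding reach_def by (rule sym_rtrancl)
  then show "(a, b) \<in> reach F \<Longrightarrow> (b, a) \<in> reach F" by (auto dest: symD)
qed

lemma reach_edge: "{a, b} \<in> F \<Longrightarrow> (a, b) \<in> reach F"
  unfolding reach_def by auto

lemma reach_subsetI:
  assumes "\<And>a b. {a, b} \<in> F \<Longrightarrow> (a, b) \<in> reach F'"
  shows "reach F \<subseteq> reach F'"
proof -
  have "{(a, b). {a, b} \<in> F} \<subseteq> reach F'" using assms by auto
  then have "reach F \<subseteq> (reach F')\<^sup>*" unfolding reach_def[of F] by (rule rtrancl_mono)
  then show ?thesis by (simp add: reach_def)
qed

lemma reach_mono: "F \<subseteq> F' \<Longrightarrow> reach F \<subseteq> reach F'"
  by (rule reach_subsetI) (auto intro: reach_edge)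

lemma reach_class_eq: "(a, b) \<in> reach F \<longleftrightarrow> reach F `` {a} = reach F `` {b}"
  by (auto intro: reach_trans reach_sym)

lemma reach_empty: "reach {} = Id"
  by (simp add: reach_def)

text \<open>
  A path can be shortened so that it uses the new edge at most once.
\<close>

lemma reach_insert:
  "(x, y) \<in> reach (insert {a, b} F) \<longleftrightarrow>
     (x, y) \<in> reach F \<or> ((x, a) \<in> reach F \<and> (b, y) \<in> reach F) \<or> ((x, b) \<in> reach F \<and> (a, y) \<in> reach F)"
  (is "?L \<longleftrightarrow> ?R x y")
proof
  have "(x, z) \<in> reach (insert {a, b} F) \<Longrightarrow> ?R x z" for z
    unfolding reach_def[of "insert {a, b} F"]
  proof (induction rule: rtrancl_induct)
    case base then show ?case by simp
  next
    case (step y z)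
    then have "{y, z} \<in> F \<or> (y = a \<and> z = b) \<or> (y = b \<and> z = a)" by (auto simp: doubleton_eq_iff)
    then show ?case using step.IH
      by (meson reach_edge reach_refl reach_trans reach_sym)
  qed
  then show "?L \<Longrightarrow> ?R x y" .
next
  have m: "reach F \<subseteq> reach (insert {a, b} F)" by (rule reach_mono) auto
  have e: "(a, b) \<in> reach (insert {a, b} F)" "(b, a) \<in> reach (insert {a, b} F)"
    by (auto intro!: reach_edge simp: insert_commute)
  show "?R x y \<Longrightarrow> ?L" using m e by (meson reach_trans subsetD)
qed

lemma reach_closed:
  assumes "\<And>a b. {a, b} \<in> F \<Longrightarrow> a \<in> C \<Longrightarrow> b \<in> C" "v \<in> C"
  shows "reach F `` {v} \<subseteq> C"
proof -
  have "(v, z) \<in> reach F \<Longrightarrow> z \<in> C" for z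
    unfolding reach_def by (induction rule: rtrancl_induct) (use assms in auto)
  then show ?thesis by auto
qed

lemma pairs_onE:
  assumes "e \<in> pairs_on W" obtains a b where "e = {a, b}" "a \<in> W" "b \<in> W" "a \<noteq> b"
  using assms unfolding pairs_on_def by auto

lemma pairs_on_restrict: "e \<in> pairs_on V \<Longrightarrow> e \<subseteq> S \<Longrightarrow> e \<in> pairs_on S"
  by (erule pairs_onE) (auto simp: pairs_on_def)

lemma pairs_on_avoid: "e \<in> pairs_on V \<Longrightarrow> e \<inter> S = {} \<Longrightarrow> e \<in> pairs_on (V - S)"
  by (erule pairs_onE) (auto simp: pairs_on_def)

lemma finite_pairs_on: "finite W \<Longrightarrow> finite (pairs_on W)"
  by (rule finite_subset[of _ "Pow W"]) (auto simp: pairs_on_def)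

text \<open>
  The new edge merges exactly the classes of its two ends.
\<close>

lemma comps_insert:
  assumes "finite W" "a \<in> W" "b \<in> W" "(a, b) \<notin> reach F"
  shows "card (comps (insert {a, b} F) W) + 1 = card (comps F W)"
proof -
  define c where "c v = reach F `` {v}" for v
  have mem: "(v, z) \<in> reach F \<longleftrightarrow> z \<in> c v" "(v, z) \<in> reach F \<longleftrightarrow> c v = c z" for v z
    by (auto simp: c_def reach_class_eq)
  have ca: "reach (insert {a, b} F) `` {v} = (if c v = c a \<or> c v = c b then c a \<union> c b else c v)" for v
  proof (rule Set.set_eqI)
    fix z
    have "z \<in> reach (insert {a, b} F) `` {v} \<longleftrightarrow>
        z \<in> c v \<or> (c v = c a \<and> z \<in> c b) \<or> (c v = c b \<and> z \<in> c a)"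
      by (simp add: reach_insert mem(1)[of b] mem(1)[of a] mem(1)[of v z] mem(2)[symmetric])
    then show "z \<in> reach (insert {a, b} F) `` {v} \<longleftrightarrow>
        z \<in> (if c v = c a \<or> c v = c b then c a \<union> c b else c v)" by auto
  qed
  have ab: "c a \<noteq> c b" using assms(4) by (simp add: c_def reach_class_eq)
  have eq: "comps (insert {a, b} F) W = insert (c a \<union> c b) (c ` W - {c a, c b})"
    unfolding comps_def ca using assms(2,3) by auto
  have "c a \<union> c b \<notin> c ` W - {c a, c b}"
  proof
    assume "c a \<union> c b \<in> c ` W - {c a, c b}"
    then obtain v where v: "c v = c a \<union> c b" "c v \<noteq> c a" by auto
    then have "a \<in> c v" by (simp add: c_def)
    then have "c v = c a" using reach_class_eq[of v a F] by (simp add: c_def)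
    then show False using v by simp
  qed
  then have "card (comps (insert {a, b} F) W) = card (c ` W - {c a, c b}) + 1"
    unfolding eq using assms(1) by simp
  also have "card (c ` W - {c a, c b}) = card (c ` W) - 2"
    using assms(1-3) ab by (subst card_Diff_subset) auto
  finally show ?thesis
    using card_mono[of "c ` W" "{c a, c b}"] assms(1-3) ab by (auto simp: comps_def c_def)
qed

lemma comps_insert_same:
  assumes "(a, b) \<in> reach F" shows "comps (insert {a, b} F) W = comps F W"
proof -
  have "reach (insert {a, b} F) = reach F"
  proof
    show "reach (insert {a, b} F) \<subseteq> reach F"
    proof (rule reach_subsetI)
      fix c d assume "{c, d} \<in> insert {a, b} F"
      then show "(c, d) \<in> reach F"
        using assms reach_sym[OF assms] reach_edge[of c d F] by (auto simp: doubleton_eq_iff)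
    qed
  qed (auto intro!: reach_mono)
  then show ?thesis by (simp add: comps_def)
qed

lemma comps_empty: "card (comps {} W) = card W"
proof -
  have "comps {} W = (\<lambda>v. {v}) ` W" by (auto simp: comps_def reach_empty)
  then show ?thesis by (simp add: card_image)
qed

text \<open>
  Starting from \<open>card W\<close> singletons, each edge merges at most two classes.
\<close>

lemma card_comps_lower:
  assumes "finite W" "F \<subseteq> pairs_on W"
  shows "card W \<le> card (comps F W) + card F"
proof -
  have "finite F" using assms finite_pairs_on finite_subset by blast
  then show ?thesis using assms(2)
  proof (induction F rule: finite_induct)
    case empty then show ?case by (simp add: comps_empty)
  next
    case (insert e F)
    from insert.prems obtain a b where e: "e = {a, b}" "a \<in> W" "b \<in> W" by (auto elim: pairs_onE)
    show ?case
      using insert comps_insert[OF assms(1) e(2,3), of F] comps_insert_same[of a b F W]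
      by (cases "(a, b) \<in> reach F") (auto simp: e)
  qed
qed

lemma forest_subset:
  assumes "forest_edges F" "F' \<subseteq> F" shows "forest_edges F'"
  unfolding forest_edges_def
proof (intro allI impI)
  fix a b assume ab: "a \<noteq> b" "{a, b} \<in> F'"
  then have "(a, b) \<notin> reach (F - {{a, b}})" using assms unfolding forest_edges_def by blast
  moreover have "reach (F' - {{a, b}}) \<subseteq> reach (F - {{a, b}})" using assms(2) by (intro reach_mono) blast
  ultimately show "(a, b) \<notin> reach (F' - {{a, b}})" by blast
qed

text \<open>
  In a forest no edge is redundant, so each edge merges two distinct classes and the bound of
  \<open>card_comps_lower\<close> is attained.
\<close>

lemma card_comps_forest:
  assumes "finite W" "F \<subseteq> pairs_on W" "forest_edges F"
  shows "card (comps F W) + card F = card W"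
proof -
  have "finite F" using assms finite_pairs_on finite_subset by blast
  then show ?thesis using assms(2,3)
  proof (induction F rule: finite_induct)
    case empty then show ?case by (simp add: comps_empty)
  next
    case (insert e F)
    from insert.prems obtain a b where e: "e = {a, b}" "a \<in> W" "b \<in> W" "a \<noteq> b"
      by (auto elim: pairs_onE)
    have "(a, b) \<notin> reach F"
      using insert.prems(2) insert.hyps(2) e unfolding forest_edges_def
      by (metis Diff_insert_absorb insertI1)
    moreover have "forest_edges F" using insert.prems(2) by (rule forest_subset) auto
    ultimately show ?case
      using insert comps_insert[OF assms(1) e(2,3), of F] by (auto simp: e)
  qed
qed

lemma card_comps_joins:
  assumes "joins F W" "W \<noteq> {}" shows "card (comps F W) = 1"
proof -
  obtain v where v: "v \<in> W" using assms by auto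
  have "reach F `` {w} = reach F `` {v}" if "w \<in> W" for w
    using assms(1) v that reach_class_eq[of w v F] unfolding joins_def by blast
  then have "comps F W = (\<lambda>w. reach F `` {v}) ` W" unfolding comps_def by (rule image_cong[OF refl])
  then show ?thesis using v by (simp add: image_constant[of v])
qed

lemma forest_edges_less:
  assumes "finite W" "F \<subseteq> pairs_on W" "forest_edges F" "W \<noteq> {}"
  shows "card F + 1 \<le> card W"
proof -
  have "comps F W \<noteq> {}" "finite (comps F W)" using assms by (auto simp: comps_def)
  then have "card (comps F W) \<ge> 1" by (simp add: Suc_leI card_gt_0_iff)
  then show ?thesis using card_comps_forest[OF assms(1-3)] by linarith
qed

lemma joins_mono: "joins F W \<Longrightarrow> reach F \<subseteq> reach F' \<Longrightarrow> joins F' W"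
  unfolding joins_def by blast

lemma reach_remove_redundant:
  assumes "(a, b) \<in> reach (F - {{a, b}})"
  shows "reach F \<subseteq> reach (F - {{a, b}})"
proof (rule reach_subsetI)
  fix c d assume cd: "{c, d} \<in> F"
  show "(c, d) \<in> reach (F - {{a, b}})"
  proof (cases "{c, d} = {a, b}")
    case True then show ?thesis using assms by (auto simp: doubleton_eq_iff intro: reach_sym)
  next
    case False then show ?thesis using cd by (auto intro: reach_edge)
  qed
qed

text \<open>
  A redundant edge could be removed from a connecting edge set, leaving fewer edges than a single
  component requires. Together with \<open>exists_spanning_tree\<close> this justifies describing spanning trees
  by connectedness and an upper bound on the number of edges.
\<close>

lemma tree_forest:
  assumes "finite W" "F \<subseteq> pairs_on W" "joins F W" "card F + 1 \<le> card W"
  shows "forest_edges F"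
  unfolding forest_edges_def
proof (intro allI impI notI)
  fix a b assume ab: "a \<noteq> b" "{a, b} \<in> F" "(a, b) \<in> reach (F - {{a, b}})"
  have fF: "finite F" using assms finite_pairs_on finite_subset by blast
  have "joins (F - {{a, b}}) W" using assms(3) reach_remove_redundant[OF ab(3)] by (rule joins_mono)
  moreover have "W \<noteq> {}" using assms(4) by auto
  ultimately have "card (comps (F - {{a, b}}) W) = 1" by (rule card_comps_joins)
  moreover have "card W \<le> card (comps (F - {{a, b}}) W) + card (F - {{a, b}})"
    using assms by (intro card_comps_lower) auto
  moreover have "card (F - {{a, b}}) < card F" using fF ab by (intro psubset_card_mono) auto
  ultimately show False using assms(4) by linarith
qed

text \<open>
  An inclusion-minimal connecting edge set has no redundant edge.
\<close>

lemma exists_spanning_tree: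
  assumes "finite V" "V \<noteq> {}" "E \<subseteq> pairs_on V" "joins E V"
  shows "\<exists>T\<subseteq>E. joins T V \<and> card T + 1 \<le> card V"
proof -
  have fE: "finite E" using assms finite_pairs_on finite_subset by blast
  define \<T> where "\<T> = {T. T \<subseteq> E \<and> joins T V}"
  have "finite \<T>" "\<T> \<noteq> {}" using fE assms(4) by (auto simp: \<T>_def)
  then obtain T where T: "T \<in> \<T>" and min: "\<And>T'. T' \<in> \<T> \<Longrightarrow> T' \<subseteq> T \<Longrightarrow> T' = T"
    using finite_has_minimal[of \<T>] by metis
  have TE: "T \<subseteq> E" and TV: "joins T V" using T by (auto simp: \<T>_def)
  have "forest_edges T"
    unfolding forest_edges_def
  proof (intro allI impI notI)
    fix a b assume ab: "a \<noteq> b" "{a, b} \<in> T" "(a, b) \<in> reach (T - {{a, b}})"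
    have "joins (T - {{a, b}}) V" by (rule joins_mono[OF TV reach_remove_redundant[OF ab(3)]])
    then have "T - {{a, b}} \<in> \<T>" using TE by (auto simp: \<T>_def)
    then have "T - {{a, b}} = T" by (rule min) (rule Diff_subset)
    moreover have "{a, b} \<notin> T - {{a, b}}" by simp
    ultimately show False using ab(2) by metis
  qed
  then have "card T + 1 \<le> card V"
    by (rule forest_edges_less[OF assms(1) order_trans[OF TE assms(3)] _ assms(2)])
  with TE TV show ?thesis by (intro exI[of _ T] conjI)
qed

lemma inside_subset: "inside F C \<subseteq> F" by (auto simp: inside_def)
lemma avoid_subset: "avoid F C \<subseteq> F" by (auto simp: avoid_def)
lemma avoid_antimono: "S' \<subseteq> S \<Longrightarrow> avoid F S \<subseteq> avoid F S'" by (auto simp: avoid_def)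
lemma inside_mono: "C \<subseteq> C' \<Longrightarrow> inside F C \<subseteq> inside F C'" by (auto simp: inside_def)

lemma reach_avoid_class:
  assumes "F \<subseteq> pairs_on V" "v \<in> V - S"
  shows "reach (avoid F S) `` {v} \<subseteq> V - S"
proof (rule reach_closed)
  fix a b assume "{a, b} \<in> avoid F S"
  then show "b \<in> V - S" using assms(1) by (auto simp: avoid_def pairs_on_def doubleton_eq_iff)
qed (use assms in auto)

lemma reach_inside_class:
  assumes "C = reach F `` {v}" "F \<subseteq> F'" shows "joins (inside F' C) C"
proof -
  have "(v, z) \<in> reach F \<Longrightarrow> (v, z) \<in> reach (inside F' C)" for z
    unfolding reach_def[of F]
  proof (induction rule: rtrancl_induct)
    case base then show ?case by simp
  next
    case (step y z)
    have yz: "{y, z} \<in> F" using step by auto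
    have "y \<in> C" using step(1) assms by (auto simp: reach_def)
    moreover from this have "z \<in> C" using yz assms reach_edge reach_trans by fastforce
    ultimately have "{y, z} \<in> inside F' C" using yz assms by (auto simp: inside_def)
    then show ?case using step.IH reach_edge reach_trans by fast
  qed
  then show ?thesis unfolding joins_def assms(1) by (auto intro: reach_trans reach_sym)
qed

lemma edge_degree_mono: "finite F' \<Longrightarrow> (\<And>e. e \<in> F \<Longrightarrow> v \<in> e \<Longrightarrow> e \<in> F') \<Longrightarrow> edge_degree F v \<le> edge_degree F' v"
  unfolding edge_degree_def by (intro card_mono) auto

lemma edge_degree_less:
  "finite F' \<Longrightarrow> (\<And>e. e \<in> F \<Longrightarrow> v \<in> e \<Longrightarrow> e \<in> F') \<Longrightarrow> f \<in> F' \<Longrightarrow> f \<notin> F \<Longrightarrow> v \<in> f \<Longrightarrow> edge_degree F v < edge_degree F' v"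
  unfolding edge_degree_def by (intro psubset_card_mono) auto

lemma edge_degree_insert_le: "finite F \<Longrightarrow> edge_degree (insert e F) v \<le> edge_degree F v + 1"
proof -
  assume f: "finite F"
  have "{x \<in> insert e F. v \<in> x} \<subseteq> insert e {x \<in> F. v \<in> x}" by auto
  then have "edge_degree (insert e F) v \<le> card (insert e {x \<in> F. v \<in> x})"
    unfolding edge_degree_def using f by (intro card_mono) auto
  also have "\<dots> \<le> edge_degree F v + 1" unfolding edge_degree_def using f by (simp add: card_insert_if)
  finally show ?thesis .
qed

text \<open>
  The new set \<open>F'\<close> may lose edges of \<open>T\<close> within \<open>K\<close> as long as it connects \<open>K\<close> by other edges.
\<close>

lemma reach_replace:
  assumes "joins F K" "\<And>a b. {a, b} \<in> T \<Longrightarrow> {a, b} \<notin> F' \<Longrightarrow> a \<in> K \<and> b \<in> K" "F \<subseteq> F'"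
  shows "reach T \<subseteq> reach F'"
proof (rule reach_subsetI)
  fix a b assume "{a, b} \<in> T"
  then show "(a, b) \<in> reach F'"
    using assms reach_mono[OF assms(3)] reach_edge[of a b F'] unfolding joins_def by blast
qed

text \<open>
  Count the edges of the tree that meet \<open>S\<close>: the degree sum over \<open>S\<close> counts those inside \<open>S\<close>
  twice, and there are at most \<open>card S - 1\<close> of these since they form a forest. The remaining edges lie
  on \<open>V - S\<close>, where few edges mean many components. If all degrees on \<open>S\<close> are at least \<open>k\<close>, this gives
  at least \<open>(k - 2) * card S + 2\<close> components.
\<close>

lemma comps_tree_minus:
  assumes "finite V" "T \<subseteq> pairs_on V" "joins T V" "card T + 1 \<le> card V" "S \<subseteq> V" "S \<noteq> {}"
  shows "(\<Sum>v\<in>S. edge_degree T v) + 2 \<le> card (comps (avoid T S) (V - S)) + 2 * card S"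
proof -
  have fT: "finite T" using assms finite_pairs_on finite_subset by blast
  have fS: "finite S" using assms finite_subset by blast
  have two: "card (e \<inter> S) = (if e \<inter> S \<noteq> {} then 1 else 0) + (if e \<subseteq> S then 1 else 0)" if "e \<in> T" for e
  proof -
    have "e \<in> pairs_on V" using that assms(2) by blast
    then obtain a b where "e = {a, b}" "a \<noteq> b" by (rule pairs_onE)
    then show ?thesis by (cases "a \<in> S"; cases "b \<in> S") (auto simp: Int_insert_left)
  qed
  have "(\<Sum>v\<in>S. edge_degree T v) = (\<Sum>v\<in>S. \<Sum>e\<in>T. if v \<in> e then 1 else 0)"
    unfolding edge_degree_def using fT by (simp add: sum.If_cases Int_def)
  also have "\<dots> = (\<Sum>e\<in>T. \<Sum>v\<in>S. if v \<in> e then 1 else 0)" by (rule sum.swap)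
  also have "\<dots> = (\<Sum>e\<in>T. card (e \<inter> S))"
    using fS by (intro sum.cong) (auto simp: sum.If_cases Int_def conj_commute)
  also have "\<dots> = (\<Sum>e\<in>T. (if e \<inter> S \<noteq> {} then 1 else 0) + (if e \<subseteq> S then 1 else 0))"
    using two by (intro sum.cong) auto
  also have "\<dots> = card {e \<in> T. e \<inter> S \<noteq> {}} + card (inside T S)"
    using fT by (simp add: sum.distrib sum.If_cases Int_def inside_def)
  finally have sum: "(\<Sum>v\<in>S. edge_degree T v) = card {e \<in> T. e \<inter> S \<noteq> {}} + card (inside T S)" .
  have split: "card T = card {e \<in> T. e \<inter> S \<noteq> {}} + card (avoid T S)"
    unfolding avoid_def using fT by (subst card_Un_disjoint[symmetric]) (auto intro: arg_cong[of _ _ card])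
  have "forest_edges T" using assms by (intro tree_forest) auto
  then have "forest_edges (inside T S)" using inside_subset by (rule forest_subset)
  moreover have "inside T S \<subseteq> pairs_on S"
    using assms(2) pairs_on_restrict by (auto simp: inside_def)
  ultimately have in_S: "card (inside T S) + 1 \<le> card S"
    using fS assms(6) by (intro forest_edges_less) auto
  have "avoid T S \<subseteq> pairs_on (V - S)"
    using assms(2) pairs_on_avoid by (auto simp: avoid_def)
  then have "card (V - S) \<le> card (comps (avoid T S) (V - S)) + card (avoid T S)"
    using assms by (intro card_comps_lower) auto
  moreover have "card (V - S) + card S = card V"
    using assms by (metis card_Diff_subset card_mono fS le_add_diff_inverse2)
  ultimately show ?thesis using sum split in_S assms(4) by linarith
qed

text \<open>
  A minimal connecting subset is the edge set of a path from \<open>u\<close> to \<open>w\<close>; working with it avoids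
  representing paths as sequences.
\<close>

lemma finite_edges_minimal:
  assumes "finite T" "(u, w) \<in> reach T"
  obtains Q where "Q \<subseteq> T" "(u, w) \<in> reach Q" "\<And>f. f \<in> Q \<Longrightarrow> (u, w) \<notin> reach (Q - {f})"
proof -
  define \<Q> where "\<Q> = {Q. Q \<subseteq> T \<and> (u, w) \<in> reach Q}"
  have "finite \<Q>" "\<Q> \<noteq> {}" using assms by (auto simp: \<Q>_def)
  then obtain Q where Q: "Q \<in> \<Q>" "\<forall>Q'\<in>\<Q>. Q' \<subseteq> Q \<longrightarrow> Q = Q'"
    using finite_has_minimal[of \<Q>] by blast
  have "(u, w) \<notin> reach (Q - {f})" if "f \<in> Q" for f
  proof
    assume "(u, w) \<in> reach (Q - {f})"
    then have "Q - {f} \<in> \<Q>" using Q(1) by (auto simp: \<Q>_def)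
    then show False using Q(2) that by blast
  qed
  then show ?thesis using that Q(1) by (auto simp: \<Q>_def)
qed

text \<open>
  Removing the edge \<open>f\<close> of the path separates \<open>u\<close> from \<open>w\<close>, so one end of \<open>f\<close> is still reachable
  from \<open>u\<close> without it.
\<close>

lemma minimal_path_verts:
  assumes Q: "(u, w) \<in> reach Q" "\<And>f. f \<in> Q \<Longrightarrow> (u, w) \<notin> reach (Q - {f})" "Q \<subseteq> pairs_on V"
    and f: "f \<in> Q" "z \<in> f"
  shows "(u, z) \<in> reach Q"
proof -
  have "f \<in> pairs_on V" using f Q(3) by blast
  then obtain p q where pq: "f = {p, q}" by (rule pairs_onE)
  have "Q = insert {p, q} (Q - {f})" using f(1) pq by auto
  then have "(u, w) \<in> reach (insert {p, q} (Q - {f}))" using Q(1) by simp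
  then have "(u, p) \<in> reach (Q - {f}) \<or> (u, q) \<in> reach (Q - {f})"
    using Q(2)[OF f(1)] by (auto simp: reach_insert)
  then have "(u, p) \<in> reach Q \<or> (u, q) \<in> reach Q" using reach_mono[of "Q - {f}" Q] by blast
  moreover have "(p, q) \<in> reach Q" "(q, p) \<in> reach Q"
    using f(1) pq by (auto intro!: reach_edge simp: insert_commute)
  ultimately have "(u, p) \<in> reach Q" "(u, q) \<in> reach Q" using reach_trans[of u _ Q] by blast+
  then show ?thesis using f(2) pq by auto
qed

section \<open>Rewiring a spanning tree\<close>

definition excess :: "nat \<Rightarrow> 'a set \<Rightarrow> 'a set set \<Rightarrow> nat" where
  "excess k V T = (\<Sum>v\<in>V. edge_degree T v - k)"

definition component :: "'a set set \<Rightarrow> 'a set \<Rightarrow> 'a \<Rightarrow> 'a set" where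
  "component T S v = reach (avoid T S) `` {v}"

text \<open>
  \<open>F\<close> can take the place of the part of the tree \<open>T\<close> inside \<open>C\<close>: the result is again a spanning tree,
  in which \<open>v\<close> has degree below \<open>k\<close> and all of \<open>C\<close> has degree at most \<open>k\<close>. Because only edges inside
  \<open>C\<close> change, rewirings of disjoint sets can be carried out simultaneously.
\<close>

definition rewires :: "nat \<Rightarrow> 'a set set \<Rightarrow> 'a set set \<Rightarrow> 'a set \<Rightarrow> 'a \<Rightarrow> 'a set set \<Rightarrow> bool" where
  "rewires k E T C v F \<longleftrightarrow> F \<subseteq> inside E C \<and> joins F C \<and> card F \<le> card (inside T C)
     \<and> edge_degree (T - inside T C \<union> F) v < k \<and> (\<forall>y\<in>C. edge_degree (T - inside T C \<union> F) y \<le> k)"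

text \<open>
  A vertex outside \<open>S\<close> is releasable if a rewiring of its own component of \<open>T - S\<close> frees it to receive
  one more edge.
\<close>

definition releasable :: "nat \<Rightarrow> 'a set set \<Rightarrow> 'a set set \<Rightarrow> 'a set \<Rightarrow> 'a \<Rightarrow> bool" where
  "releasable k E T S v \<longleftrightarrow> (\<exists>F. rewires k E T (component T S v) v F)"

locale spanning_tree_of =
  fixes V :: "'a set" and E T :: "'a set set"
  assumes fin: "finite V" and E: "E \<subseteq> pairs_on V"
    and T: "T \<subseteq> E" and T_joins: "joins T V" and T_card: "card T + 1 \<le> card V"
begin

lemma T_pairs: "T \<subseteq> pairs_on V" using T E by blast
lemma fin_E: "finite E" using E fin finite_pairs_on finite_subset by blast
lemma fin_T: "finite T" using T fin_E finite_subset by blast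

lemma component_subset: "v \<in> V - S \<Longrightarrow> component T S v \<subseteq> V - S"
  unfolding component_def using T_pairs by (rule reach_avoid_class)

lemma component_antimono: "S' \<subseteq> S \<Longrightarrow> component T S v \<subseteq> component T S' v"
  unfolding component_def using reach_mono[OF avoid_antimono[of S' S T]] by blast

lemma self_in_component: "v \<in> component T S v"
  by (simp add: component_def)

lemma joins_component: "joins (inside T (component T S v)) (component T S v)"
  unfolding component_def by (rule reach_inside_class[OF refl avoid_subset])

lemma component_eq: "w \<in> component T S v \<Longrightarrow> component T S w = component T S v"
  unfolding component_def using reach_class_eq[of v w "avoid T S"] by simp

text \<open>
  Shrinking \<open>S\<close> enlarges the component \<open>C\<close> of \<open>v\<close> to some \<open>K\<close>; the old rewiring of \<open>C\<close> together with
  the unchanged tree edges of \<open>K\<close> outside \<open>C\<close> is a rewiring of \<open>K\<close>.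
\<close>

lemma releasable_antimono:
  assumes rel: "releasable k E T S v" and v: "v \<in> V - S" and sub: "S' \<subseteq> S"
    and low: "\<And>y. y \<in> V - S' \<Longrightarrow> edge_degree T y \<le> k"
  shows "releasable k E T S' v"
proof -
  define C where "C = component T S v"
  define K where "K = component T S' v"
  obtain F where F: "rewires k E T C v F" using rel by (auto simp: releasable_def C_def)
  have CK: "C \<subseteq> K" unfolding C_def K_def using sub by (rule component_antimono)
  have KV: "K \<subseteq> V - S'" unfolding K_def using v sub by (intro component_subset) auto
  define F' where "F' = inside T K - inside T C \<union> F"
  have FC: "F \<subseteq> inside E C" and Fj: "joins F C" and Fc: "card F \<le> card (inside T C)"
    using F by (auto simp: rewires_def)
  have TC: "inside T C \<subseteq> inside T K" using CK by (rule inside_mono)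
  have eq: "T - inside T K \<union> F' = T - inside T C \<union> F"
    using TC inside_subset[of T K] by (auto simp: F'_def)
  have "rewires k E T K v F'"
    unfolding rewires_def eq
  proof (intro conjI ballI)
    show "F' \<subseteq> inside E K"
      using FC CK T by (auto simp: F'_def inside_def)
    have "reach (inside T K) \<subseteq> reach F'"
      by (rule reach_replace[OF Fj]) (auto simp: F'_def inside_def)
    then show "joins F' K"
      using joins_component[of S' v] joins_mono unfolding K_def by blast
    have "finite (inside T K)" "finite F" using fin_T fin_E FC inside_subset finite_subset by metis+
    then have "card F' \<le> card (inside T K - inside T C) + card F"
      unfolding F'_def by (intro card_Un_le)
    also have "card (inside T K - inside T C) = card (inside T K) - card (inside T C)"
      using TC \<open>finite (inside T K)\<close> finite_subset by (intro card_Diff_subset) auto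
    finally show "card F' \<le> card (inside T K)"
      using Fc card_mono[OF \<open>finite (inside T K)\<close> TC] by linarith
    show "edge_degree (T - inside T C \<union> F) v < k" using F by (simp add: rewires_def)
    fix y assume y: "y \<in> K"
    show "edge_degree (T - inside T C \<union> F) y \<le> k"
    proof (cases "y \<in> C")
      case True then show ?thesis using F by (simp add: rewires_def)
    next
      case False
      then have "edge_degree (T - inside T C \<union> F) y \<le> edge_degree T y"
        using fin_T FC by (intro edge_degree_mono) (auto simp: inside_def)
      then show ?thesis using low[of y] y KV by auto
    qed
  qed
  then show ?thesis unfolding releasable_def K_def by blast
qed

text \<open>
  The exchange step. \<open>Q\<close> is the tree path from \<open>u\<close> to \<open>w\<close>, and \<open>f\<close> an edge on it at \<open>x\<close>. Rewire
  \<open>C\<close> and \<open>C'\<close> so that \<open>u\<close> and \<open>w\<close> have spare degree, add \<open>{u, w}\<close>, and remove \<open>f\<close>. The vertex \<open>x\<close> loses an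
  edge, and no vertex outside \<open>C \<union> C'\<close> gains any.
\<close>

lemma swap_on_path:
  assumes uw: "{u, w} \<in> E" and Q: "Q \<subseteq> T" "(u, w) \<in> reach Q"
    and Q_min: "\<And>f. f \<in> Q \<Longrightarrow> (u, w) \<notin> reach (Q - {f})"
    and Q_K: "\<Union>Q \<subseteq> K" and K: "joins (inside T K) K" "u \<in> K" "w \<in> K"
    and C: "u \<in> C" "w \<in> C'" "C \<inter> C' = {}" "C \<subseteq> K" "C' \<subseteq> K"
    and Fu: "rewires k E T C u Fu" and Fw: "rewires k E T C' w Fw"
    and f: "f \<in> Q" "x \<in> f" "x \<notin> C" "x \<notin> C'"
  obtains F where "F \<subseteq> inside E K" "joins F K" "card F \<le> card (inside T K)"
    "\<And>y. y \<in> C \<union> C' \<Longrightarrow> edge_degree (T - inside T K \<union> F) y \<le> k"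
    "\<And>y. y \<notin> C \<union> C' \<Longrightarrow> edge_degree (T - inside T K \<union> F) y \<le> edge_degree T y"
    "edge_degree (T - inside T K \<union> F) x < edge_degree T x"
proof -
  let ?TK = "inside T K" and ?TC = "inside T C" and ?TC' = "inside T C'"
  define R where "R = ?TK - ?TC - ?TC' - {f}"
  define F where "F = insert {u, w} (R \<union> Fu \<union> Fw)"
  have FuC: "Fu \<subseteq> inside E C" and Fuj: "joins Fu C" and Fuc: "card Fu \<le> card ?TC"
    and FwC: "Fw \<subseteq> inside E C'" and Fwj: "joins Fw C'" and Fwc: "card Fw \<le> card ?TC'"
    using Fu Fw by (auto simp: rewires_def)
  have fins: "finite ?TK" "finite ?TC" "finite ?TC'" "finite Fu" "finite Fw"
    using fin_T fin_E FuC FwC inside_subset finite_subset by metis+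
  have sub: "?TC \<subseteq> ?TK" "?TC' \<subseteq> ?TK" using C inside_mono[of _ K T] by auto
  have fT: "f \<in> T" using f Q by blast
  have fK: "f \<in> ?TK" using f(1) Q Q_K by (auto simp: inside_def)
  have fC: "f \<notin> ?TC" "f \<notin> ?TC'" using f by (auto simp: inside_def)
  have disj: "?TC \<inter> ?TC' = {}"
  proof -
    have "e \<noteq> {}" if "e \<in> T" for e using that T_pairs by (auto simp: pairs_on_def)
    then show ?thesis using C(3) by (fastforce simp: inside_def)
  qed
  have "f \<in> pairs_on V" using fT T_pairs by blast
  then obtain p q where pq: "f = {p, q}" "p \<noteq> q" by (rule pairs_onE)
  have Qf: "Q = insert {p, q} (Q - {f})" using f(1) pq by auto
  have "(u, w) \<in> reach (insert {p, q} (Q - {f}))" using Q(2) Qf by simp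
  then have sides: "(u, p) \<in> reach (Q - {f}) \<and> (q, w) \<in> reach (Q - {f}) \<or>
      (u, q) \<in> reach (Q - {f}) \<and> (p, w) \<in> reach (Q - {f})"
    using Q_min[OF f(1)] by (auto simp: reach_insert)
  have QTK: "Q - {f} \<subseteq> ?TK - {f}" using Q Q_K by (auto simp: inside_def)
  \<comment> \<open>Removing an edge of the path from the tree leaves just two parts, that of \<open>u\<close> and that of \<open>w\<close>.\<close>
  have from_end: "(u, y) \<in> reach (?TK - {f}) \<or> (w, y) \<in> reach (?TK - {f})" if y: "y \<in> K" for y
  proof -
    have "(u, y) \<in> reach ?TK" using K y by (auto simp: joins_def)
    moreover have "?TK = insert {p, q} (?TK - {f})" using fK pq by auto
    ultimately have "(u, y) \<in> reach (insert {p, q} (?TK - {f}))" by simp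
    then have "(u, y) \<in> reach (?TK - {f}) \<or> (p, y) \<in> reach (?TK - {f}) \<or> (q, y) \<in> reach (?TK - {f})"
      by (auto simp: reach_insert)
    moreover have "(u, p) \<in> reach (?TK - {f}) \<and> (q, w) \<in> reach (?TK - {f}) \<or>
      (u, q) \<in> reach (?TK - {f}) \<and> (p, w) \<in> reach (?TK - {f})"
      using sides reach_mono[OF QTK] by blast
    ultimately show ?thesis by (meson reach_trans reach_sym)
  qed
  have step: "reach (?TK - {f}) \<subseteq> reach F"
  proof (rule reach_subsetI)
    fix a b assume ab: "{a, b} \<in> ?TK - {f}"
    show "(a, b) \<in> reach F"
    proof (cases "{a, b} \<in> R")
      case True then show ?thesis by (auto simp: F_def intro: reach_edge)
    next
      case False
      then consider "a \<in> C" "b \<in> C" | "a \<in> C'" "b \<in> C'" using ab by (auto simp: R_def inside_def)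
      then have "(a, b) \<in> reach Fu \<or> (a, b) \<in> reach Fw"
        using Fuj Fwj by cases (auto simp: joins_def)
      moreover have "Fu \<subseteq> F" "Fw \<subseteq> F" by (auto simp: F_def)
      ultimately show ?thesis using reach_mono by blast
    qed
  qed
  have uwF: "(u, w) \<in> reach F" by (auto simp: F_def intro: reach_edge)
  have from_u: "(u, y) \<in> reach F" if "y \<in> K" for y
    using from_end[OF that] step uwF by (meson reach_trans subsetD)
  show ?thesis
  proof (rule that)
    have "Fu \<subseteq> inside E K" "Fw \<subseteq> inside E K"
      using FuC FwC inside_mono[OF C(4), of E] inside_mono[OF C(5), of E] by auto
    then show "F \<subseteq> inside E K"
      using T uw K(2,3) by (auto simp: F_def R_def inside_def)
    show "joins F K" unfolding joins_def using from_u by (meson reach_sym reach_trans)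
    have "card ?TC + card ?TC' + 1 = card (insert f (?TC \<union> ?TC'))"
      using fins fC disj by (simp add: card_Un_disjoint)
    moreover have "card R = card ?TK - card (insert f (?TC \<union> ?TC'))"
    proof -
      have "R = ?TK - insert f (?TC \<union> ?TC')" by (auto simp: R_def)
      then show ?thesis using fins sub fK by (simp only:) (intro card_Diff_subset; auto)
    qed
    moreover have "card (insert f (?TC \<union> ?TC')) \<le> card ?TK"
      using fins sub fK by (intro card_mono) auto
    moreover have "card F \<le> card R + card Fu + card Fw + 1"
    proof -
      have "card F \<le> card (R \<union> Fu \<union> Fw) + 1" unfolding F_def by (rule card_insert_le_m1) auto
      also have "card (R \<union> Fu \<union> Fw) \<le> card (R \<union> Fu) + card Fw" by (rule card_Un_le)
      also have "card (R \<union> Fu) \<le> card R + card Fu" by (rule card_Un_le)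
      finally show ?thesis by simp
    qed
    ultimately show "card F \<le> card ?TK" using Fuc Fwc by linarith
    have new: "T - ?TK \<union> F = insert {u, w} (T - ?TC - ?TC' - {f} \<union> Fu \<union> Fw)"
      using sub fK inside_subset[of T K] by (auto simp: F_def R_def)
    have finN: "finite (T - ?TC \<union> Fu)" "finite (T - ?TC' \<union> Fw)" using fin_T fins by auto
    show "edge_degree (T - ?TK \<union> F) y \<le> k" if "y \<in> C \<union> C'" for y
    proof -
      \<comment> \<open>The roles of \<open>(u, C)\<close> and \<open>(w, C')\<close> are symmetric: \<open>D\<close> is the rewired set that contains \<open>y\<close>, and \<open>z\<close> the end of the new edge in \<open>D\<close>.\<close>
      have gen: "edge_degree (insert {u, w} (T - ?TC - ?TC' - {f} \<union> Fu \<union> Fw)) y \<le> k"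
        if "y \<in> D" "D \<inter> D' = {}" "rewires k E T D z G" "G' \<subseteq> inside E D'" 
          "z \<in> D" "z' \<in> D'" "{z, z'} = {u, w}" "T - ?TC - ?TC' - {f} \<union> Fu \<union> Fw \<subseteq> T - inside T D \<union> G \<union> G'"
        for D D' z z' G G'
      proof -
        have D: "edge_degree (T - inside T D \<union> G) z < k" "\<forall>y\<in>D. edge_degree (T - inside T D \<union> G) y \<le> k" "G \<subseteq> inside E D"
          using that(3) by (auto simp: rewires_def)
        have finG: "finite (T - inside T D \<union> G)"
          using fin_T fin_E D(3) inside_subset finite_subset by (metis finite_Diff finite_UnI)
        have *: "e \<in> T - inside T D \<union> G" 
          if "e \<in> insert {u, w} (T - ?TC - ?TC' - {f} \<union> Fu \<union> Fw)" "y \<in> e" "e \<noteq> {z, z'}" for e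
        proof -
          have "e \<in> T - inside T D \<union> G \<union> G'" using that \<open>{z, z'} = {u, w}\<close>
            \<open>T - ?TC - ?TC' - {f} \<union> Fu \<union> Fw \<subseteq> T - inside T D \<union> G \<union> G'\<close> by auto
          moreover have "e \<notin> G'" using that(2) \<open>y \<in> D\<close> \<open>D \<inter> D' = {}\<close> \<open>G' \<subseteq> inside E D'\<close> 
            by (auto simp: inside_def)
          ultimately show ?thesis by blast
        qed
        show ?thesis
        proof (cases "y = z")
          case True
          have "edge_degree (insert {u, w} (T - ?TC - ?TC' - {f} \<union> Fu \<union> Fw)) y \<le> edge_degree (insert {z, z'} (T - inside T D \<union> G)) y"
            using * finG by (intro edge_degree_mono) auto
          also have "\<dots> \<le> edge_degree (T - inside T D \<union> G) y + 1" using finG by (rule edge_degree_insert_le)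
          finally show ?thesis using D(1) True by simp
        next
          case False
          have "y \<noteq> z'" using that by auto
          then have "edge_degree (insert {u, w} (T - ?TC - ?TC' - {f} \<union> Fu \<union> Fw)) y \<le> edge_degree (T - inside T D \<union> G) y"
            using * finG False by (intro edge_degree_mono) auto
          then show ?thesis using D(2) \<open>y \<in> D\<close> le_trans by blast
        qed
      qed
      from that consider "y \<in> C" | "y \<in> C'" by blast
      then show ?thesis
      proof cases
        case 1
        show ?thesis unfolding new by (rule gen[of C C' u Fu Fw w]) (use 1 C Fu FwC in auto)
      next
        case 2
        show ?thesis unfolding new by (rule gen[of C' C w Fw Fu u]) (use 2 C Fw FuC in auto)
      qed
    qed
    have away: "e \<in> T - {f}" if "y \<notin> C \<union> C'" "y \<in> e" "e \<in> T - ?TK \<union> F" for y e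
    proof -
      have "e \<noteq> {u, w}" "e \<notin> Fu" "e \<notin> Fw" using that FuC FwC C by (auto simp: inside_def)
      then show ?thesis using that(3) unfolding new by auto
    qed
    show "edge_degree (T - ?TK \<union> F) y \<le> edge_degree T y" if "y \<notin> C \<union> C'" for y
      using fin_T away[OF that] by (intro edge_degree_mono) auto
    have "x \<notin> C \<union> C'" using f by auto
    then have "e \<in> T \<and> e \<noteq> f" if "e \<in> T - ?TK \<union> F" "x \<in> e" for e
      using that away by blast
    then show "edge_degree (T - ?TK \<union> F) x < edge_degree T x"
      using fin_T fT f(2) by (intro edge_degree_less[of _ _ _ f]) auto
  qed
qed

text \<open>
  Let \<open>{u, w}\<close> join two components of \<open>T - S\<close>. All vertices of \<open>S\<close> on the tree path from \<open>u\<close> to \<open>w\<close>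
  leave \<open>S\<close> at once, because only then does one component of \<open>T - S'\<close> contain the whole path together
  with the components of \<open>u\<close> and \<open>w\<close>, so that the exchange \<open>swap_on_path\<close> takes place inside it.
\<close>

lemma release_step:
  assumes tree_min: "\<And>T'. T' \<subseteq> E \<Longrightarrow> joins T' V \<Longrightarrow> card T' + 1 \<le> card V \<Longrightarrow> excess k V T \<le> excess k V T'"
    and S: "S \<subseteq> V" and rel: "\<And>v. v \<in> V - S \<Longrightarrow> releasable k E T S v"
    and low: "\<And>v. v \<in> V - S \<Longrightarrow> edge_degree T v \<le> k"
    and uw: "{u, w} \<in> E" "u \<in> V - S" "w \<in> V - S" "(u, w) \<notin> reach (avoid T S)"
  obtains S' where "S' \<subset> S" "\<And>v. v \<in> V - S' \<Longrightarrow> releasable k E T S' v" "\<And>v. v \<in> V - S' \<Longrightarrow> edge_degree T v \<le> k"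
proof -
  have "(u, w) \<in> reach T" using T_joins uw by (auto simp: joins_def)
  then obtain Q where Q: "Q \<subseteq> T" "(u, w) \<in> reach Q" 
    and Q_min: "\<And>f. f \<in> Q \<Longrightarrow> (u, w) \<notin> reach (Q - {f})"
    using finite_edges_minimal[OF fin_T] by blast
  define P where "P = S \<inter> \<Union>Q"
  define S' where "S' = S - P"
  define C where "C = component T S u"
  define C' where "C' = component T S w"
  define K where "K = component T S' u"
  have P_ne: "P \<noteq> {}"
  proof
    assume "P = {}"
    then have "Q \<subseteq> avoid T S" using Q(1) by (auto simp: P_def avoid_def)
    then show False using Q(2) uw(4) reach_mono by blast
  qed
  have S'S: "S' \<subseteq> S" "S' \<subset> S" using P_ne by (auto simp: S'_def P_def)
  have Q_avoid: "Q \<subseteq> avoid T S'" using Q(1) by (auto simp: S'_def P_def avoid_def)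
  have Q_K: "\<Union>Q \<subseteq> K"
  proof
    fix z assume "z \<in> \<Union>Q"
    then obtain f where "f \<in> Q" "z \<in> f" by blast
    then have "(u, z) \<in> reach Q"
      using minimal_path_verts[OF Q(2) Q_min order_trans[OF Q(1) T_pairs]] by blast
    then show "z \<in> K" using reach_mono[OF Q_avoid] by (auto simp: K_def component_def)
  qed
  have uK: "u \<in> K" by (simp add: K_def self_in_component)
  have wK: "w \<in> K" using Q(2) reach_mono[OF Q_avoid] by (auto simp: K_def component_def)
  have CK: "C \<subseteq> K" unfolding C_def K_def using S'S(1) by (rule component_antimono)
  have "C' \<subseteq> component T S' w" unfolding C'_def using S'S(1) by (rule component_antimono)
  then have C'K: "C' \<subseteq> K" using component_eq[of w S' u] wK by (simp add: K_def)
  have disj: "C \<inter> C' = {}"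
  proof (rule ccontr)
    assume "C \<inter> C' \<noteq> {}"
    then obtain z where "(u, z) \<in> reach (avoid T S)" "(w, z) \<in> reach (avoid T S)"
      by (auto simp: C_def C'_def component_def)
    then have "(u, w) \<in> reach (avoid T S)" by (blast intro: reach_trans reach_sym)
    then show False using uw(4) by blast
  qed
  have CV: "C \<subseteq> V - S" "C' \<subseteq> V - S" unfolding C_def C'_def using uw by (auto intro!: component_subset)
  have KV: "K \<subseteq> V - S'" unfolding K_def using uw S'S by (intro component_subset) auto
  obtain Fu where Fu: "rewires k E T C u Fu" using rel[OF uw(2)] by (auto simp: releasable_def C_def)
  obtain Fw where Fw: "rewires k E T C' w Fw" using rel[OF uw(3)] by (auto simp: releasable_def C'_def)
  have swap: "\<exists>F. F \<subseteq> inside E K \<and> joins F K \<and> card F \<le> card (inside T K) \<and>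
     (\<forall>y \<in> C \<union> C'. edge_degree (T - inside T K \<union> F) y \<le> k) \<and>
     (\<forall>y. y \<notin> C \<union> C' \<longrightarrow> edge_degree (T - inside T K \<union> F) y \<le> edge_degree T y) \<and>
     edge_degree (T - inside T K \<union> F) x < edge_degree T x" if x: "x \<in> P" for x
  proof -
    obtain f where f: "f \<in> Q" "x \<in> f" using x by (auto simp: P_def)
    have "x \<notin> C" "x \<notin> C'" using x CV by (auto simp: P_def)
    moreover have "joins (inside T K) K" unfolding K_def by (rule joins_component)
    moreover have "u \<in> C" "w \<in> C'" by (simp_all add: C_def C'_def self_in_component)
    ultimately show ?thesis
      using swap_on_path[OF uw(1) Q Q_min Q_K _ uK wK _ _ disj CK C'K Fu Fw f] by (metis (no_types, lifting))
  qed
  \<comment> \<open>A vertex of degree above \<open>k\<close> on the path would allow an exchange that lowers the total excess.\<close>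
  have P_low: "edge_degree T x \<le> k" if x: "x \<in> P" for x
  proof (rule ccontr)
    assume high: "\<not> edge_degree T x \<le> k"
    obtain F where F: "F \<subseteq> inside E K" "joins F K" "card F \<le> card (inside T K)"
      "\<forall>y \<in> C \<union> C'. edge_degree (T - inside T K \<union> F) y \<le> k"
      "\<forall>y. y \<notin> C \<union> C' \<longrightarrow> edge_degree (T - inside T K \<union> F) y \<le> edge_degree T y"
      "edge_degree (T - inside T K \<union> F) x < edge_degree T x"
      using swap[OF x] by blast
    let ?T' = "T - inside T K \<union> F"
    have "?T' \<subseteq> E" using T F(1) by (auto simp: inside_def)
    moreover have "reach T \<subseteq> reach ?T'" by (rule reach_replace[OF F(2)]) (auto simp: inside_def)
    then have "joins ?T' V" by (rule joins_mono[OF T_joins])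
    moreover have "card ?T' + 1 \<le> card V"
    proof -
      have fK: "finite (inside T K)" using fin_T inside_subset finite_subset by blast
      have "card ?T' \<le> card (T - inside T K) + card F" by (rule card_Un_le)
      also have "card (T - inside T K) = card T - card (inside T K)"
        using fK inside_subset by (intro card_Diff_subset)
      finally show ?thesis using F(3) T_card card_mono[OF fin_T inside_subset[of T K]] by linarith
    qed
    ultimately have "excess k V T \<le> excess k V ?T'" by (rule tree_min)
    moreover have "excess k V ?T' < excess k V T"
      unfolding excess_def
    proof (rule sum_strict_mono_ex1[OF fin])
      show "\<forall>y\<in>V. edge_degree ?T' y - k \<le> edge_degree T y - k"
      proof
        fix y
        show "edge_degree ?T' y - k \<le> edge_degree T y - k"
          using F(4,5) by (cases "y \<in> C \<union> C'") (auto intro: diff_le_mono)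
      qed
      show "\<exists>y\<in>V. edge_degree ?T' y - k < edge_degree T y - k"
        using x S high F(6) by (intro bexI[of _ x]) (auto simp: P_def)
    qed
    ultimately show False by simp
  qed
  have low': "edge_degree T v \<le> k" if "v \<in> V - S'" for v
    using that low P_low by (auto simp: S'_def)
  have "releasable k E T S' v" if v: "v \<in> V - S'" for v
  proof (cases "v \<in> S")
    case False
    then show ?thesis using releasable_antimono[OF rel _ S'S(1) low'] v by blast
  next
    case True
    then have vP: "v \<in> P" using v by (auto simp: S'_def)
    then have "v \<in> K" using Q_K by (auto simp: P_def)
    then have K: "component T S' v = K" unfolding K_def by (rule component_eq)
    obtain F where F: "F \<subseteq> inside E K" "joins F K" "card F \<le> card (inside T K)"
      "\<forall>y \<in> C \<union> C'. edge_degree (T - inside T K \<union> F) y \<le> k"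
      "\<forall>y. y \<notin> C \<union> C' \<longrightarrow> edge_degree (T - inside T K \<union> F) y \<le> edge_degree T y"
      "edge_degree (T - inside T K \<union> F) v < edge_degree T v"
      using swap[OF vP] by blast
    have "edge_degree (T - inside T K \<union> F) y \<le> k" if "y \<in> K" for y
      using F(4,5) low'[of y] KV that by (cases "y \<in> C \<union> C'") (auto intro: le_trans)
    then have "rewires k E T K v F"
      using F(1-3,6) low'[OF v] by (auto simp: rewires_def)
    then show ?thesis by (auto simp: releasable_def K)
  qed
  then show ?thesis using that S'S(2) low' by blast
qed

text \<open>
  Repeat \<open>release_step\<close>, starting from all vertices of degree at least \<open>k\<close>, until every edge of the graph
  outside \<open>S\<close> stays within a component of \<open>T - S\<close>. Initially each vertex outside the set has degree
  below \<open>k\<close> and is releasable by changing nothing.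
\<close>

lemma saturated_separator:
  assumes tree_min: "\<And>T'. T' \<subseteq> E \<Longrightarrow> joins T' V \<Longrightarrow> card T' + 1 \<le> card V \<Longrightarrow> excess k V T \<le> excess k V T'"
  obtains S where "S \<subseteq> V" "\<And>v. v \<in> S \<Longrightarrow> k \<le> edge_degree T v" "\<And>v. v \<in> V - S \<Longrightarrow> edge_degree T v \<le> k"
    "\<And>u w. {u, w} \<in> avoid E S \<Longrightarrow> (u, w) \<in> reach (avoid T S)"
proof -
  define \<S> where "\<S> = {S. S \<subseteq> {v \<in> V. k \<le> edge_degree T v} \<and> (\<forall>v\<in>V - S. edge_degree T v \<le> k)
     \<and> (\<forall>v\<in>V - S. releasable k E T S v)}"
  define S0 where "S0 = {v \<in> V. k \<le> edge_degree T v}"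
  have "releasable k E T S0 v" if v: "v \<in> V - S0" for v
  proof -
    let ?C = "component T S0 v"
    have C: "?C \<subseteq> V - S0" using v by (rule component_subset)
    have eq: "T - inside T ?C \<union> inside T ?C = T" using inside_subset[of T ?C] by blast
    have "edge_degree T y < k" if "y \<in> V - S0" for y using that by (auto simp: S0_def)
    moreover have "inside T ?C \<subseteq> inside E ?C" using T by (auto simp: inside_def)
    ultimately have "rewires k E T ?C v (inside T ?C)"
      unfolding rewires_def eq using v C joins_component by (auto intro: less_imp_le)
    then show ?thesis unfolding releasable_def by blast
  qed
  then have "S0 \<in> \<S>" by (auto simp: \<S>_def S0_def)
  moreover have "finite \<S>" using fin by (auto simp: \<S>_def intro: finite_subset[of _ "Pow V"])
  ultimately obtain S where S: "S \<in> \<S>" "\<forall>S'\<in>\<S>. S' \<subseteq> S \<longrightarrow> S = S'"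
    using finite_has_minimal[of \<S>] by blast
  have SV: "S \<subseteq> V" and low: "\<And>v. v \<in> V - S \<Longrightarrow> edge_degree T v \<le> k"
    and rel: "\<And>v. v \<in> V - S \<Longrightarrow> releasable k E T S v" and high: "\<And>v. v \<in> S \<Longrightarrow> k \<le> edge_degree T v"
    using S(1) by (auto simp: \<S>_def)
  have "(u, w) \<in> reach (avoid T S)" if uw: "{u, w} \<in> avoid E S" for u w
  proof (rule ccontr)
    assume not: "(u, w) \<notin> reach (avoid T S)"
    have "{u, w} \<in> E" "u \<in> V - S" "w \<in> V - S"
      using uw E by (auto simp: avoid_def pairs_on_def doubleton_eq_iff)
    then obtain S' where "S' \<subset> S" "\<And>v. v \<in> V - S' \<Longrightarrow> releasable k E T S' v"
        "\<And>v. v \<in> V - S' \<Longrightarrow> edge_degree T v \<le> k"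
      using release_step[OF tree_min SV rel low _ _ _ not] by blast
    then have "S' \<in> \<S>" using S(1) by (auto simp: \<S>_def)
    then show False using S(2) \<open>S' \<subset> S\<close> by blast
  qed
  then show ?thesis using that SV low high by blast
qed

end

section \<open>Win's theorem\<close>

text \<open>
  For a tree of least excess, the set \<open>S\<close> of \<open>saturated_separator\<close> contains every vertex of degree above
  \<open>k\<close>, has degrees at least \<open>k\<close>, and its removal leaves the same components in the graph as in the tree.
  If a degree above \<open>k\<close> occurred, \<open>comps_tree_minus\<close> would give too many components.
\<close>

lemma spanning_tree_of_bounded_degree:
  assumes "finite V" "V \<noteq> {}" "E \<subseteq> pairs_on V" "joins E V" "k \<ge> 2"
    and tough: "\<And>S. S \<subseteq> V \<Longrightarrow> S \<noteq> {} \<Longrightarrow> card (comps (avoid E S) (V - S)) \<le> (k - 2) * card S + 2"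
  obtains T where "T \<subseteq> E" "joins T V" "card T + 1 \<le> card V" "\<And>v. v \<in> V \<Longrightarrow> edge_degree T v \<le> k"
proof -
  define is_tree where "is_tree T \<longleftrightarrow> T \<subseteq> E \<and> joins T V \<and> card T + 1 \<le> card V" for T
  obtain T0 where "is_tree T0" using exists_spanning_tree[OF assms(1-4)] unfolding is_tree_def by blast
  then obtain T where "is_tree T" and le: "\<And>T'. is_tree T' \<Longrightarrow> excess k V T \<le> excess k V T'"
    using ex_has_least_nat[of is_tree T0 "excess k V"] by metis
  then have tree: "T \<subseteq> E" "joins T V" "card T + 1 \<le> card V"
    and tree_min: "\<And>T'. T' \<subseteq> E \<Longrightarrow> joins T' V \<Longrightarrow> card T' + 1 \<le> card V \<Longrightarrow> excess k V T \<le> excess k V T'"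
    by (auto simp: is_tree_def)
  interpret spanning_tree_of V E T using assms tree by unfold_locales
  obtain S where S: "S \<subseteq> V" "\<And>v. v \<in> S \<Longrightarrow> k \<le> edge_degree T v" "\<And>v. v \<in> V - S \<Longrightarrow> edge_degree T v \<le> k"
    and closed: "\<And>u w. {u, w} \<in> avoid E S \<Longrightarrow> (u, w) \<in> reach (avoid T S)"
    using saturated_separator[OF tree_min] by blast
  have "edge_degree T v \<le> k" if v: "v \<in> V" for v
  proof (rule ccontr)
    assume "\<not> edge_degree T v \<le> k"
    then have vS: "v \<in> S" "k < edge_degree T v" using S(3)[of v] v by auto
    have fS: "finite S" using S(1) fin finite_subset by blast
    have "reach (avoid E S) = reach (avoid T S)"
    proof
      show "reach (avoid E S) \<subseteq> reach (avoid T S)" by (rule reach_subsetI) (rule closed)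
      show "reach (avoid T S) \<subseteq> reach (avoid E S)" using tree(1) by (intro reach_mono) (auto simp: avoid_def)
    qed
    then have "card (comps (avoid T S) (V - S)) \<le> (k - 2) * card S + 2"
      using tough[OF S(1)] vS by (auto simp: comps_def)
    moreover have "(\<Sum>v\<in>S. edge_degree T v) + 2 \<le> card (comps (avoid T S) (V - S)) + 2 * card S"
      using fin T_pairs T_joins T_card S(1) vS by (intro comps_tree_minus) auto
    moreover have "(\<Sum>v\<in>S. k) < (\<Sum>v\<in>S. edge_degree T v)"
      using fS S(2) vS by (intro sum_strict_mono_ex1) auto
    moreover have "(k - 2) * card S + 2 * card S = k * card S"
      by (metis add_mult_distrib assms(5) le_add_diff_inverse2)
    ultimately show False by (simp add: mult.commute)
  qed
  with tree show ?thesis by (rule that)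
qed

section \<open>The spectral theorem for real symmetric matrices\<close>

text \<open>
  Over the complex numbers an eigenvalue exists; it is real because the Hermitian form of a real
  symmetric matrix takes real values. A real root of the characteristic polynomial has a real
  eigenvector.
\<close>

lemma symmetric_real_eigenvector:
  fixes A :: "real mat"
  assumes A: "A \<in> carrier_mat n n" and sym: "transpose_mat A = A" and n: "n > 0"
  obtains e v where "v \<in> carrier_vec n" "v \<noteq> 0\<^sub>v n" "A *\<^sub>v v = e \<cdot>\<^sub>v v"
proof -
  define B where "B = map_mat complex_of_real A"
  have B: "B \<in> carrier_mat n n" using A by (simp add: B_def)
  obtain z where z: "eigenvalue B z" using spectrum_non_empty[OF B n] by (auto simp: spectrum_def)
  then obtain w where w: "w \<in> carrier_vec n" "w \<noteq> 0\<^sub>v n" "B *\<^sub>v w = z \<cdot>\<^sub>v w"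
    using B by (auto simp: eigenvalue_def eigenvector_def)
  have aij: "A $$ (j, i) = A $$ (i, j)" if "i < n" "j < n" for i j
    using sym A that by (metis carrier_matD index_transpose_mat(1))
  define s where "s = (\<Sum>i<n. \<Sum>j<n. complex_of_real (A $$ (i, j)) * w $ j * cnj (w $ i))"
  define N where "N = (\<Sum>i<n. w $ i * cnj (w $ i))"
  have N0: "N \<noteq> 0"
  proof -
    have "w \<bullet>c w = N" using w by (simp add: scalar_prod_def N_def atLeast0LessThan)
    then show ?thesis using conjugate_square_eq_0_vec[OF w(1)] w(2) by auto
  qed
  have "s = (\<Sum>i<n. (B *\<^sub>v w) $ i * cnj (w $ i))"
  proof -
    have "(B *\<^sub>v w) $ i = (\<Sum>j<n. complex_of_real (A $$ (i, j)) * w $ j)" if "i < n" for i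
      using that w(1) A by (simp add: B_def scalar_prod_def atLeast0LessThan)
    then show ?thesis unfolding s_def by (intro sum.cong refl) (simp add: sum_distrib_right)
  qed
  also have "\<dots> = z * N" using w by (simp add: N_def sum_distrib_left mult.assoc)
  finally have s: "s = z * N" .
  have "cnj s = (\<Sum>i<n. \<Sum>j<n. complex_of_real (A $$ (i, j)) * cnj (w $ j) * w $ i)"
    by (simp add: s_def)
  also have "\<dots> = (\<Sum>j<n. \<Sum>i<n. complex_of_real (A $$ (i, j)) * cnj (w $ j) * w $ i)"
    by (rule sum.swap)
  also have "\<dots> = s" unfolding s_def
    by (intro sum.cong refl) (use aij in \<open>auto simp: mult_ac\<close>)
  finally have "cnj z * cnj N = z * N" using s by simp
  moreover have "cnj N = N" by (simp add: N_def mult.commute)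
  ultimately have "cnj z = z" using N0 by simp
  then obtain e where e: "z = complex_of_real e" by (metis Reals_cnj_iff Reals_cases)
  have "poly (char_poly B) z = 0" using z eigenvalue_root_char_poly[OF B] by simp
  moreover have "char_poly B = map_poly complex_of_real (char_poly A)"
    unfolding B_def by (rule of_real_hom.char_poly_hom[OF A])
  ultimately have "poly (char_poly A) e = 0" by (simp add: e of_real_hom.poly_map_poly)
  then have "eigenvalue A e" using eigenvalue_root_char_poly[OF A] by simp
  then show ?thesis using that A by (auto simp: eigenvalue_def eigenvector_def)
qed

text \<open>
  Complete \<open>v\<close> to a basis, orthogonalise, and normalise the columns.
\<close>

lemma orthogonal_mat_first_column:
  fixes v :: "real vec"
  assumes v: "v \<in> carrier_vec n" "v \<noteq> 0\<^sub>v n"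
  obtains W c where "W \<in> carrier_mat n n" "transpose_mat W * W = 1\<^sub>m n" "col W 0 = c \<cdot>\<^sub>v v" 
proof -
  interpret cof_vec_space n "TYPE(real)" .
  define ws where "ws = gram_schmidt n (basis_completion v)"
  note bc = basis_completion[OF v]
  have n: "n > 0" using v by (cases n) auto
  have ws: "corthogonal ws" "set ws \<subseteq> carrier_vec n" "length ws = n"
    using gram_schmidt_result[OF bc(2,4,5) ws_def] bc(6) by auto
  have "basis_completion v = v # tl (basis_completion v)" using bc(6,7) n by (cases "basis_completion v") auto
  then have "hd ws = v" unfolding ws_def using v(1) by (metis gram_schmidt_hd)
  then have ws0: "ws ! 0 = v" using ws(3) n by (cases ws) auto
  have wsc: "ws ! i \<in> carrier_vec n" if "i < n" for i using ws that by auto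
  have orth: "ws ! i \<bullet> ws ! j = 0 \<longleftrightarrow> i \<noteq> j" if "i < n" "j < n" for i j
    using corthogonalD[OF ws(1), of i j] that ws(3) by simp
  have pos: "ws ! i \<bullet> ws ! i > 0" if "i < n" for i
  proof -
    have "ws ! i \<bullet> ws ! i \<ge> 0" unfolding scalar_prod_def by (intro sum_nonneg) auto
    then show ?thesis using orth[OF that that] by simp
  qed
  define W where "W = mat n n (\<lambda>(i, j). (1 / sqrt (ws ! j \<bullet> ws ! j)) * (ws ! j) $ i)"
  have W: "W \<in> carrier_mat n n" by (simp add: W_def)
  have colW: "col W j = (1 / sqrt (ws ! j \<bullet> ws ! j)) \<cdot>\<^sub>v (ws ! j)" if "j < n" for j
    using that wsc[OF that] by (intro eq_vecI) (auto simp: W_def)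
  have "transpose_mat W * W = 1\<^sub>m n"
  proof (rule eq_matI)
    fix i j assume ij: "i < dim_row (1\<^sub>m n :: real mat)" "j < dim_col (1\<^sub>m n :: real mat)"
    then have "(transpose_mat W * W) $$ (i, j) = col W i \<bullet> col W j" using W by simp
    also have "\<dots> = (ws ! i \<bullet> ws ! j) / (sqrt (ws ! i \<bullet> ws ! i) * sqrt (ws ! j \<bullet> ws ! j))"
      using ij wsc by (simp add: colW smult_scalar_prod_distrib[of _ n] scalar_prod_smult_distrib[of _ n])
    also have "\<dots> = (1\<^sub>m n) $$ (i, j)"
      using ij orth[of i j] pos[of j] by (cases "i = j") auto
    finally show "(transpose_mat W * W) $$ (i, j) = (1\<^sub>m n) $$ (i, j)" .
  qed (use W in auto)
  then show ?thesis using that W colW[OF n] ws0 by metis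
qed

text \<open>
  Conjugating by an orthogonal matrix whose first column is an eigenvector gives a matrix whose first
  column, and by symmetry first row, vanishes off the diagonal. The remaining block is again
  symmetric.
\<close>

lemma spectral_theorem_real:
  fixes A :: "real mat"
  assumes "A \<in> carrier_mat n n" "transpose_mat A = A"
  shows "\<exists>P f. P \<in> carrier_mat n n \<and> transpose_mat P * P = 1\<^sub>m n \<and> A = P * mat_diag n f * transpose_mat P"
  using assms
proof (induction n arbitrary: A)
  case 0
  then show ?case by (intro exI[of _ "1\<^sub>m 0"] exI[of _ "\<lambda>_. 0"]) auto
next
  case (Suc m)
  let ?n = "Suc m"
  have A: "A \<in> carrier_mat ?n ?n" and sym: "transpose_mat A = A" using Suc by auto
  obtain e v where v: "v \<in> carrier_vec ?n" "v \<noteq> 0\<^sub>v ?n" "A *\<^sub>v v = e \<cdot>\<^sub>v v"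
    using symmetric_real_eigenvector[OF A sym zero_less_Suc] by blast
  obtain W c where W: "W \<in> carrier_mat ?n ?n" "transpose_mat W * W = 1\<^sub>m ?n" "col W 0 = c \<cdot>\<^sub>v v"
    using orthogonal_mat_first_column[OF v(1,2)] by blast
  let ?Wt = "transpose_mat W"
  have Wt: "?Wt \<in> carrier_mat ?n ?n" using W by auto
  have WWt: "W * ?Wt = 1\<^sub>m ?n" by (rule mat_mult_left_right_inverse[OF Wt W(1,2)])
  define B where "B = ?Wt * A * W"
  have B: "B \<in> carrier_mat ?n ?n" using Wt A W(1) by (auto simp: B_def)
  have Bsym: "transpose_mat B = B"
    using Wt A W(1) sym by (simp add: B_def transpose_mult[of _ ?n ?n _ ?n] assoc_mult_mat[of _ ?n ?n _ ?n _ ?n])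
  have AB: "A = W * B * ?Wt"
  proof -
    have "W * B * ?Wt = W * ?Wt * A * (W * ?Wt)"
      using Wt A W(1) by (simp add: B_def assoc_mult_mat[of _ ?n ?n _ ?n _ ?n])
    then show ?thesis using A WWt by simp
  qed
  have B0: "B $$ (i, 0) = (if i = 0 then e else 0)" if i: "i < ?n" for i
  proof -
    have "col W 0 \<in> carrier_vec ?n" using col_dim[of W 0] W(1) by simp
    moreover have "col B 0 = (?Wt * A) *\<^sub>v col W 0"
      unfolding B_def using mult_carrier_mat[OF Wt A] W(1) by (rule col_mult2) simp
    ultimately have "col B 0 = ?Wt *\<^sub>v (A *\<^sub>v col W 0)"
      using assoc_mult_mat_vec[OF Wt A] by simp
    also have "A *\<^sub>v col W 0 = e \<cdot>\<^sub>v col W 0"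
      using A v(1,3) by (simp add: W(3) mult_mat_vec[of _ ?n ?n] smult_smult_assoc mult.commute)
    also have "?Wt *\<^sub>v (e \<cdot>\<^sub>v col W 0) = e \<cdot>\<^sub>v (?Wt *\<^sub>v col W 0)"
      using col_dim[of W 0] Wt W(1) by (intro mult_mat_vec[of _ ?n ?n]) simp_all
    also have "?Wt *\<^sub>v col W 0 = col (1\<^sub>m ?n) 0"
      using Wt W(1,2) col_mult2[of ?Wt ?n ?n W ?n 0] by simp
    finally have "col B 0 $ i = (e \<cdot>\<^sub>v col (1\<^sub>m ?n) 0) $ i" by simp
    then show ?thesis using B i by simp
  qed
  define A' where "A' = mat m m (\<lambda>(i, j). B $$ (Suc i, Suc j))"
  have A': "A' \<in> carrier_mat m m" by (simp add: A'_def)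
  have Bij: "B $$ (j, i) = B $$ (i, j)" if "i < ?n" "j < ?n" for i j
    using Bsym B that by (metis carrier_matD index_transpose_mat(1))
  have "transpose_mat A' = A'" by (rule eq_matI) (auto simp: A'_def Bij)
  from Suc.IH[OF A' this] obtain P f where P: "P \<in> carrier_mat m m" "transpose_mat P * P = 1\<^sub>m m"
    "A' = P * mat_diag m f * transpose_mat P" by blast
  let ?Pt = "transpose_mat P"
  have Pt: "?Pt \<in> carrier_mat m m" using P by auto
  let ?FB = "\<lambda>a D. four_block_mat a (0\<^sub>m 1 m) (0\<^sub>m m 1) D :: real mat"
  define Q where "Q = ?FB (1\<^sub>m 1) P"
  define f' where "f' i = (case i of 0 \<Rightarrow> e | Suc j \<Rightarrow> f j)" for i
  have Q: "Q \<in> carrier_mat ?n ?n" unfolding Q_def using P four_block_carrier_mat[of "1\<^sub>m 1" 1 1 P m m] by simp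
  have Qt: "transpose_mat Q = ?FB (1\<^sub>m 1) ?Pt"
    unfolding Q_def using P by (subst transpose_four_block_mat[of _ 1 1 _ m _ m]) auto
  have QtQ: "transpose_mat Q * Q = 1\<^sub>m ?n"
    unfolding Qt unfolding Q_def using P Pt
    by (subst mult_four_block_mat[of _ 1 1 _ m _ m _ _ 1 _ m]) auto
  have diag: "mat_diag ?n f' = ?FB (mat 1 1 (\<lambda>_. e)) (mat_diag m f)"
    by (rule eq_matI) (auto simp: mat_diag_def f'_def split: nat.splits)
  have BQ: "B = Q * mat_diag ?n f' * transpose_mat Q"
  proof -
    have "B = ?FB (mat 1 1 (\<lambda>_. e)) A'"
    proof (rule eq_matI)
      fix i j assume "i < dim_row (?FB (mat 1 1 (\<lambda>_. e)) A')" "j < dim_col (?FB (mat 1 1 (\<lambda>_. e)) A')"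
      then have ij: "i < ?n" "j < ?n" using A' by auto
      show "B $$ (i, j) = ?FB (mat 1 1 (\<lambda>_. e)) A' $$ (i, j)"
        using ij B0[of i] B0[of j] Bij[of 0 j] A' by (cases i; cases j) (auto simp: A'_def)
    qed (use B A' in auto)
    also have "\<dots> = Q * mat_diag ?n f' * transpose_mat Q"
    proof -
      have PD: "P * mat_diag m f \<in> carrier_mat m m" using P(1) mat_diag_dim by (rule mult_carrier_mat)
      have "Q * mat_diag ?n f' = ?FB (mat 1 1 (\<lambda>_. e)) (P * mat_diag m f)"
        unfolding diag Q_def using P left_mult_zero_mat[OF mat_diag_dim[of m f]]
        by (subst mult_four_block_mat[of _ 1 1 _ m _ m _ _ 1 _ m]) auto
      moreover have "?FB (mat 1 1 (\<lambda>_. e)) (P * mat_diag m f) * transpose_mat Q = ?FB (mat 1 1 (\<lambda>_. e)) A'"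
        unfolding Qt using P Pt PD right_mult_zero_mat[OF PD, of 1] left_add_zero_mat[OF mult_carrier_mat[OF PD Pt]]
        by (subst mult_four_block_mat[of _ 1 1 _ m _ m _ _ 1 _ m]) auto
      ultimately show ?thesis by simp
    qed
    finally show ?thesis .
  qed
  let ?D = "mat_diag ?n f'"
  have D: "?D \<in> carrier_mat ?n ?n" by simp
  have Qt_c: "transpose_mat Q \<in> carrier_mat ?n ?n" using Q by auto
  have tWQ: "transpose_mat (W * Q) = transpose_mat Q * ?Wt"
    using W(1) Q by (simp add: transpose_mult)
  show ?case
  proof (intro exI[of _ "W * Q"] exI[of _ f'] conjI)
    show "W * Q \<in> carrier_mat ?n ?n" using W(1) Q by simp
    have "transpose_mat (W * Q) * (W * Q) = transpose_mat Q * (?Wt * W) * Q"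
      unfolding tWQ using W(1) Wt Q Qt_c by (simp add: assoc_mult_mat[of _ ?n ?n _ ?n _ ?n])
    then show "transpose_mat (W * Q) * (W * Q) = 1\<^sub>m ?n" using W(2) Qt_c QtQ by simp
    show "A = W * Q * ?D * transpose_mat (W * Q)"
      unfolding tWQ AB BQ using W(1) Wt Q Qt_c D
      by (simp add: assoc_mult_mat[of _ ?n ?n _ ?n _ ?n] mult_carrier_mat[of _ ?n ?n _ ?n])
  qed
qed

section \<open>Dense separated vertex sets force large eigenvalues\<close>

text \<open>
  One half of the Courant-Fischer principle. The columns of \<open>W\<close> span an \<open>r\<close>-dimensional space. If fewer
  than \<open>r\<close> eigenvalues were at least \<open>\<theta>\<close>, some nonzero vector of that space would be orthogonal to
  the corresponding eigenvectors, and on it the quadratic form would be below \<open>\<theta>\<close> times the squared norm.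
\<close>

lemma card_eigenvalues_ge:
  fixes A :: "real mat"
  assumes A: "A \<in> carrier_mat n n" "transpose_mat A = A" and W: "W \<in> carrier_mat n r"
    and W0: "\<And>c. c \<in> carrier_vec r \<Longrightarrow> c \<noteq> 0\<^sub>v r \<Longrightarrow> W *\<^sub>v c \<noteq> 0\<^sub>v n"
    and quad: "\<And>c. c \<in> carrier_vec r \<Longrightarrow> 
      (W *\<^sub>v c) \<bullet> (A *\<^sub>v (W *\<^sub>v c)) \<ge> \<theta> * ((W *\<^sub>v c) \<bullet> (W *\<^sub>v c))"
  shows "r \<le> size (filter_mset (\<lambda>x. x \<ge> \<theta>) (proots (char_poly A)))"
proof -
  obtain P f where P: "P \<in> carrier_mat n n" "transpose_mat P * P = 1\<^sub>m n"
    and AP: "A = P * mat_diag n f * transpose_mat P" using spectral_theorem_real[OF A] by blast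
  let ?Pt = "transpose_mat P" and ?D = "mat_diag n f"
  have Pt: "?Pt \<in> carrier_mat n n" using P by auto
  have PPt: "P * ?Pt = 1\<^sub>m n" by (rule mat_mult_left_right_inverse[OF Pt P])
  have D: "?D \<in> carrier_mat n n" by simp
  have "similar_mat A ?D"
  proof -
    have "{A, ?D, P, ?Pt} \<subseteq> carrier_mat (dim_row A) (dim_row A)" "n = dim_row A"
      using A P Pt D by auto
    then show ?thesis
      using PPt P(2) AP unfolding similar_mat_def similar_mat_wit_def Let_def by blast
  qed
  then have "char_poly A = char_poly ?D" by (rule char_poly_similar)
  also have "\<dots> = (\<Prod>a\<leftarrow>diag_mat ?D. [:- a, 1:])"
    by (rule char_poly_upper_triangular[OF D]) (auto simp: mat_diag_def upper_triangular_def)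
  also have "diag_mat ?D = map f [0..<n]" by (auto simp: diag_mat_def mat_diag_def)
  finally have cp: "char_poly A = (\<Prod>a\<leftarrow>map f [0..<n]. [:- a, 1:])" .
  have "proots (\<Prod>a\<leftarrow>xs. [:- a, 1:]) = mset xs" for xs :: "real list"
  proof (induction xs)
    case (Cons a xs)
    have "(\<Prod>a\<leftarrow>xs. [:- a, 1:]) \<noteq> 0" by (auto simp: prod_list_zero_iff)
    then have "proots ([:- a, 1:] * (\<Prod>a\<leftarrow>xs. [:- a, 1:])) = proots [:- a, 1:] + proots (\<Prod>a\<leftarrow>xs. [:- a, 1:])"
      by (intro proots_mult) auto
    then show ?case using Cons by (simp del: mult_pCons_left)
  qed auto
  then have roots: "proots (char_poly A) = mset (map f [0..<n])" unfolding cp .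
  define J where "J = {j. j < n \<and> f j \<ge> \<theta>}"
  have "size (filter_mset (\<lambda>x. x \<ge> \<theta>) (proots (char_poly A))) = length (filter (\<lambda>x. x \<ge> \<theta>) (map f [0..<n]))"
    unfolding roots by (metis mset_filter size_mset)
  also have "\<dots> = card J"
    by (simp add: filter_map o_def J_def length_filter_conv_card cong: conj_cong)
  finally have size: "size (filter_mset (\<lambda>x. x \<ge> \<theta>) (proots (char_poly A))) = card J" .
  have "r \<le> card J"
  proof (rule ccontr)
    assume "\<not> r \<le> card J"
    then have Jr: "card J < r" by simp
    have "finite J" by (simp add: J_def)
    then obtain g where g: "bij_betw g {0..<card J} J" using ex_bij_betw_nat_finite by blast
    let ?PW = "?Pt * W"
    have PW: "?PW \<in> carrier_mat n r" using Pt W by simp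
    \<comment> \<open>The orthogonality conditions, padded with zero rows to a square system, which is therefore singular.\<close>
    define M where "M = mat r r (\<lambda>(a, i). if a < card J then ?PW $$ (g a, i) else 0)"
    have M: "M \<in> carrier_mat r r" by (simp add: M_def)
    have "det (transpose_mat M) = 0"
    proof -
      have "transpose_mat M *\<^sub>v unit_vec r (card J) = 0\<^sub>v r"
        using M Jr by (intro eq_vecI) (auto simp: M_def)
      moreover have "unit_vec r (card J) \<noteq> (0\<^sub>v r :: real vec)" using Jr by simp
      moreover have "transpose_mat M \<in> carrier_mat r r" using M by simp
      ultimately show ?thesis using det_0_iff_vec_prod_zero[of "transpose_mat M" r] unit_vec_carrier by blast
    qed
    then have "det M = 0" using det_transpose[OF M] by simp
    then obtain c where c: "c \<in> carrier_vec r" "c \<noteq> 0\<^sub>v r" "M *\<^sub>v c = 0\<^sub>v r"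
      using det_0_iff_vec_prod_zero[OF M] by blast
    define x where "x = W *\<^sub>v c"
    define y where "y = ?Pt *\<^sub>v x"
    have x: "x \<in> carrier_vec n" "x \<noteq> 0\<^sub>v n" using W0[OF c(1,2)] W c(1) by (auto simp: x_def)
    have y: "y \<in> carrier_vec n" using Pt x by (simp add: y_def)
    have xy: "x = P *\<^sub>v y" using PPt P Pt x by (simp add: y_def assoc_mult_mat_vec[symmetric, of _ n n _ n])
    have yJ: "y $ j = 0" if "j \<in> J" for j
    proof -
      have "j \<in> g ` {0..<card J}" using g that by (simp add: bij_betw_def)
      then obtain a where a: "a < card J" "g a = j" by auto
      have j: "j < n" using that by (simp add: J_def)
      have "y = ?PW *\<^sub>v c" using Pt W c(1) by (simp add: y_def x_def assoc_mult_mat_vec[of _ n n _ r])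
      then have "y $ j = row ?PW j \<bullet> c" using j PW by (simp only: index_mult_mat_vec carrier_matD)
      also have "row ?PW j = row M a" using a j Jr W Pt by (intro eq_vecI) (auto simp: M_def)
      also have "row M a \<bullet> c = (M *\<^sub>v c) $ a" using M a Jr by simp
      also have "\<dots> = 0" using c(3) a Jr by simp
      finally show ?thesis .
    qed
    have inner: "(P *\<^sub>v u) \<bullet> (P *\<^sub>v w) = u \<bullet> w" if "u \<in> carrier_vec n" "w \<in> carrier_vec n" for u w
    proof -
      have "(P *\<^sub>v u) \<bullet> (P *\<^sub>v w) = u \<bullet> (?Pt *\<^sub>v (P *\<^sub>v w))"
        using transpose_vec_mult_scalar[of ?Pt n n "P *\<^sub>v w" u] that P Pt by simp
      also have "?Pt *\<^sub>v (P *\<^sub>v w) = w"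
        using that P Pt by (simp add: assoc_mult_mat_vec[symmetric, of _ n n _ n])
      finally show ?thesis .
    qed
    have "A *\<^sub>v x = P *\<^sub>v (?D *\<^sub>v y)"
      unfolding AP y_def using P Pt D x by (simp add: assoc_mult_mat_vec[of _ n n _ n])
    then have "x \<bullet> (A *\<^sub>v x) = y \<bullet> (?D *\<^sub>v y)" using inner[of y "?D *\<^sub>v y"] y D xy by simp
    moreover have "?D *\<^sub>v y = vec n (\<lambda>i. f i * y $ i)"
    proof (rule eq_vecI)
      fix i assume "i < dim_vec (vec n (\<lambda>i. f i * y $ i))"
      then show "(?D *\<^sub>v y) $ i = vec n (\<lambda>i. f i * y $ i) $ i"
        using y by (simp add: mat_diag_def scalar_prod_def if_distrib[of "\<lambda>z. z * _"] cong: if_cong)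
    qed (simp add: mat_diag_def)
    ultimately have xAx: "x \<bullet> (A *\<^sub>v x) = (\<Sum>i<n. f i * (y $ i)\<^sup>2)"
      by (simp add: scalar_prod_def atLeast0LessThan power2_eq_square mult_ac)
    have xx: "x \<bullet> x = (\<Sum>i<n. (y $ i)\<^sup>2)"
      using inner[OF y y] xy y by (simp add: scalar_prod_def atLeast0LessThan power2_eq_square)
    have "\<exists>i<n. y $ i \<noteq> 0"
    proof (rule ccontr)
      assume "\<not> (\<exists>i<n. y $ i \<noteq> 0)"
      then have "y = 0\<^sub>v n" using y by (intro eq_vecI) auto
      then have "x = 0\<^sub>v n" using xy P by auto
      then show False using x by simp
    qed
    then obtain i where i: "i < n" "y $ i \<noteq> 0" by blast
    have "(\<Sum>i<n. f i * (y $ i)\<^sup>2) < (\<Sum>i<n. \<theta> * (y $ i)\<^sup>2)"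
    proof (rule sum_strict_mono_ex1)
      show "\<forall>i\<in>{..<n}. f i * (y $ i)\<^sup>2 \<le> \<theta> * (y $ i)\<^sup>2"
      proof
        fix i assume "i \<in> {..<n}"
        then have "y $ i = 0 \<or> f i \<le> \<theta>" using yJ[of i] by (auto simp: J_def)
        then show "f i * (y $ i)\<^sup>2 \<le> \<theta> * (y $ i)\<^sup>2" by (auto intro: mult_right_mono)
      qed
      have "f i < \<theta>" using i yJ[of i] by (auto simp: J_def not_le[symmetric])
      then show "\<exists>i\<in>{..<n}. f i * (y $ i)\<^sup>2 < \<theta> * (y $ i)\<^sup>2"
        using i by (intro bexI[of _ i]) auto
    qed simp
    then show False using quad[OF c(1)] xAx xx by (simp add: x_def sum_distrib_left)
  qed
  then show ?thesis using size by simp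
qed

lemma nth_descending_ge:
  fixes M :: "real multiset"
  assumes "m < size (filter_mset (\<lambda>x. x \<ge> \<theta>) M)"
  shows "rev (sorted_list_of_multiset M) ! m \<ge> \<theta>"
proof (rule ccontr)
  define xs where "xs = rev (sorted_list_of_multiset M)"
  assume "\<not> ?thesis"
  then have less: "xs ! m < \<theta>" by (simp add: xs_def)
  have desc: "sorted_wrt (\<ge>) xs" by (simp add: xs_def sorted_wrt_rev)
  have "mset xs = M" by (simp add: xs_def)
  then have size: "size (filter_mset (\<lambda>x. x \<ge> \<theta>) M) = length (filter (\<lambda>x. x \<ge> \<theta>) xs)"
    by (metis mset_filter size_mset)
  also have "\<dots> = length (filter (\<lambda>x. x \<ge> \<theta>) (take m xs)) + length (filter (\<lambda>x. x \<ge> \<theta>) (drop m xs))"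
    by (metis append_take_drop_id filter_append length_append)
  also have "filter (\<lambda>x. x \<ge> \<theta>) (drop m xs) = []"
  proof -
    have "x < \<theta>" if x: "x \<in> set (drop m xs)" for x
    proof -
      obtain j where j: "j < length (drop m xs)" "drop m xs ! j = x" using x by (metis in_set_conv_nth)
      have "m + j < length xs" using j(1) unfolding length_drop by linarith
      moreover from this have "x = xs ! (m + j)" using j(2) nth_drop[of m xs j] by simp
      moreover have "xs ! (m + j) \<le> xs ! m"
        using desc \<open>m + j < length xs\<close> by (cases "j = 0") (auto simp: sorted_wrt_iff_nth_less)
      ultimately show ?thesis using less by simp
    qed
    then show ?thesis by (auto simp: filter_empty_conv not_le)
  qed
  also have "length (filter (\<lambda>x. x \<ge> \<theta>) (take m xs)) \<le> m"
    using length_filter_le[of _ "take m xs"] by (metis le_trans length_take min.cobounded2)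
  finally show False using assms by simp
qed

lemma vertex_enum:
  assumes "finite (pverts G)"
  shows "distinct (vertex_enum G)" "set (vertex_enum G) = pverts G" "length (vertex_enum G) = card (pverts G)"
proof -
  have "\<exists>vs. distinct vs \<and> set vs = pverts G" using finite_distinct_list[OF assms] by blast
  then have "distinct (vertex_enum G) \<and> set (vertex_enum G) = pverts G"
    unfolding vertex_enum_def by (rule someI_ex)
  then show "distinct (vertex_enum G)" "set (vertex_enum G) = pverts G" "length (vertex_enum G) = card (pverts G)"
    using distinct_card by fastforce+
qed

lemma sum_vertex_enum:
  fixes f :: "'a \<Rightarrow> 'b::comm_monoid_add"
  assumes "finite (pverts G)"
  shows "(\<Sum>a<card (pverts G). f (vertex_enum G ! a)) = (\<Sum>v\<in>pverts G. f v)"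
proof -
  have "bij_betw ((!) (vertex_enum G)) {..<card (pverts G)} (pverts G)"
    using vertex_enum[OF assms] by (intro bij_betw_nth) auto
  then show ?thesis by (rule sum.reindex_bij_betw)
qed

text \<open>
  For a linear combination of the indicator vectors of nonadjacent disjoint sets \<open>X\<close>, both the squared
  norm and the quadratic form of the adjacency matrix split into contributions of the single sets,
  proportional to \<open>card X\<close> and to the number of arcs inside \<open>X\<close>. So \<open>card_eigenvalues_ge\<close> applies as soon as
  the average degree inside each set is at least \<open>\<theta>\<close>.
\<close>

lemma graph_eigenvalue_ge:
  assumes G: "pair_graph G" and fin: "finite \<X>" and m: "1 \<le> m" "m \<le> card \<X>"
    and sub: "\<And>X. X \<in> \<X> \<Longrightarrow> X \<subseteq> pverts G" and ne: "\<And>X. X \<in> \<X> \<Longrightarrow> X \<noteq> {}"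
    and disj: "\<And>X Y. X \<in> \<X> \<Longrightarrow> Y \<in> \<X> \<Longrightarrow> X \<noteq> Y \<Longrightarrow> X \<inter> Y = {}"
    and sep: "\<And>X Y u v. X \<in> \<X> \<Longrightarrow> Y \<in> \<X> \<Longrightarrow> X \<noteq> Y \<Longrightarrow> u \<in> X \<Longrightarrow> v \<in> Y \<Longrightarrow> (u, v) \<notin> parcs G"
    and dense: "\<And>X. X \<in> \<X> \<Longrightarrow> \<theta> * real (card X) \<le> real (card (parcs G \<inter> X \<times> X))"
  shows "\<theta> \<le> graph_eigenvalue G m"
proof -
  interpret pair_graph G by fact
  define n where "n = card (pverts G)"
  define r where "r = card \<X>"
  define vs where "vs = vertex_enum G"
  define A where "A = adjacency_matrix G"
  have vs: "vs ! a \<in> pverts G" if "a < n" for a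
    using nth_mem[of a vs] vertex_enum(2,3)[OF pair_finite_verts] that unfolding vs_def n_def by metis
  have sum_vs: "(\<Sum>a<n. f (vs ! a)) = (\<Sum>v\<in>pverts G. f v)" for f :: "'a \<Rightarrow> real"
    unfolding n_def vs_def using pair_finite_verts by (intro sum_vertex_enum) simp
  have A: "A \<in> carrier_mat n n" by (simp add: A_def adjacency_matrix_def Let_def n_def)
  have Aij: "A $$ (i, j) = (if (vs ! i, vs ! j) \<in> parcs G then 1 else 0)" if "i < n" "j < n" for i j
    using that by (simp add: A_def adjacency_matrix_def Let_def n_def vs_def)
  have arc_sym: "(u, v) \<in> parcs G \<longleftrightarrow> (v, u) \<in> parcs G" for u v
    using sym_arcs by (auto simp: symmetric_def dest: symD)
  have At: "transpose_mat A = A" using A arc_sym by (intro eq_matI) (auto simp: Aij)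
  obtain h where h: "bij_betw h {..<r} \<X>" unfolding r_def using bij_betw_from_nat_into_finite[OF fin] by blast
  have hX: "h i \<in> \<X>" if "i < r" for i using h that by (auto simp: bij_betw_def)
  have h_inj: "h i = h j \<longleftrightarrow> i = j" if "i < r" "j < r" for i j
    using h that by (auto simp: bij_betw_def inj_on_def)
  define W where "W = mat n r (\<lambda>(a, i). if vs ! a \<in> h i then 1 else 0 :: real)"
  have W: "W \<in> carrier_mat n r" by (simp add: W_def)
  define \<phi> where "\<phi> c v = (\<Sum>i<r. c $ i * of_bool (v \<in> h i))" for c :: "real vec" and v
  have Wc: "(W *\<^sub>v c) $ a = \<phi> c (vs ! a)" if "c \<in> carrier_vec r" "a < n" for c a
    using that by (simp add: W_def \<phi>_def scalar_prod_def atLeast0LessThan of_bool_def mult.commute)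
  \<comment> \<open>Disjointness (for \<open>u = v\<close>) and nonadjacency (for arcs) remove the mixed terms.\<close>
  have \<phi>2: "\<phi> c u * \<phi> c v = (\<Sum>i<r. (c $ i)\<^sup>2 * of_bool (u \<in> h i \<and> v \<in> h i))"
    if uv: "u = v \<or> (u, v) \<in> parcs G" for c u v
  proof -
    have "\<phi> c u * \<phi> c v = (\<Sum>i<r. \<Sum>j<r. c $ i * of_bool (u \<in> h i) * (c $ j * of_bool (v \<in> h j)))"
      unfolding \<phi>_def by (rule sum_product)
    also have "\<dots> = (\<Sum>i<r. \<Sum>j<r. if j = i then (c $ i)\<^sup>2 * of_bool (u \<in> h i \<and> v \<in> h i) else 0)"
    proof (intro sum.cong refl)
      fix i j assume "i \<in> {..<r}" "j \<in> {..<r}"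
      then have ij: "i < r" "j < r" by auto
      have "\<not> (u \<in> h i \<and> v \<in> h j)" if "i \<noteq> j"
        using disj[OF hX hX, OF ij] sep[OF hX hX, OF ij] uv that h_inj[OF ij] by blast
      then show "c $ i * of_bool (u \<in> h i) * (c $ j * of_bool (v \<in> h j)) =
          (if j = i then (c $ i)\<^sup>2 * of_bool (u \<in> h i \<and> v \<in> h i) else 0)"
        by (auto simp: power2_eq_square)
    qed
    also have "\<dots> = (\<Sum>i<r. (c $ i)\<^sup>2 * of_bool (u \<in> h i \<and> v \<in> h i))" by simp
    finally show ?thesis .
  qed
  have fin_h: "finite (h i)" "card (h i) > 0" if "i < r" for i
    using finite_subset[OF sub[OF hX[OF that]] pair_finite_verts] ne[OF hX[OF that]]
    by (simp_all add: card_gt_0_iff)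
  have norm: "(W *\<^sub>v c) \<bullet> (W *\<^sub>v c) = (\<Sum>i<r. (c $ i)\<^sup>2 * real (card (h i)))" 
    if c: "c \<in> carrier_vec r" for c
  proof -
    have "(W *\<^sub>v c) \<bullet> (W *\<^sub>v c) = (\<Sum>a<n. \<phi> c (vs ! a) * \<phi> c (vs ! a))"
      using W c Wc[OF c] by (simp add: scalar_prod_def[of "W *\<^sub>v c"] atLeast0LessThan del: index_mult_mat_vec)
    also have "\<dots> = (\<Sum>v\<in>pverts G. \<phi> c v * \<phi> c v)" by (rule sum_vs)
    also have "\<dots> = (\<Sum>v\<in>pverts G. \<Sum>i<r. (c $ i)\<^sup>2 * of_bool (v \<in> h i))"
      by (intro sum.cong refl) (simp add: \<phi>2)
    also have "\<dots> = (\<Sum>i<r. \<Sum>v\<in>pverts G. (c $ i)\<^sup>2 * of_bool (v \<in> h i))" by (rule sum.swap)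
    also have "\<dots> = (\<Sum>i<r. (c $ i)\<^sup>2 * real (card (h i)))"
    proof (intro sum.cong refl)
      fix i assume "i \<in> {..<r}"
      then have "pverts G \<inter> h i = h i" using sub hX by auto
      then show "(\<Sum>v\<in>pverts G. (c $ i)\<^sup>2 * of_bool (v \<in> h i)) = (c $ i)\<^sup>2 * real (card (h i))"
        using pair_finite_verts by (simp add: sum_distrib_left[symmetric] of_bool_def sum.If_cases)
    qed
    finally show ?thesis .
  qed
  have Ax: "(A *\<^sub>v x) $ a = (\<Sum>b<n. A $$ (a, b) * x $ b)" if "x \<in> carrier_vec n" "a < n" for x a
    using that A by (simp add: scalar_prod_def atLeast0LessThan)
  have quad: "(W *\<^sub>v c) \<bullet> (A *\<^sub>v (W *\<^sub>v c)) = (\<Sum>i<r. (c $ i)\<^sup>2 * real (card (parcs G \<inter> h i \<times> h i)))"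
    if c: "c \<in> carrier_vec r" for c
  proof -
    have Wcc: "W *\<^sub>v c \<in> carrier_vec n" using W c by simp
    have "(A *\<^sub>v (W *\<^sub>v c)) $ a = (\<Sum>v\<in>pverts G. of_bool ((vs ! a, v) \<in> parcs G) * \<phi> c v)" if a: "a < n" for a
    proof -
      have "(A *\<^sub>v (W *\<^sub>v c)) $ a = (\<Sum>b<n. A $$ (a, b) * (W *\<^sub>v c) $ b)"
        using Wcc a by (rule Ax)
      also have "\<dots> = (\<Sum>b<n. of_bool ((vs ! a, vs ! b) \<in> parcs G) * \<phi> c (vs ! b))"
        using Aij a Wc[OF c] by (intro sum.cong refl) (auto simp del: index_mult_mat_vec)
      also have "\<dots> = (\<Sum>v\<in>pverts G. of_bool ((vs ! a, v) \<in> parcs G) * \<phi> c v)" by (rule sum_vs)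
      finally show ?thesis .
    qed
    then have "(W *\<^sub>v c) \<bullet> (A *\<^sub>v (W *\<^sub>v c)) = 
       (\<Sum>a<n. \<phi> c (vs ! a) * (\<Sum>v\<in>pverts G. of_bool ((vs ! a, v) \<in> parcs G) * \<phi> c v))"
      using A Wc[OF c] by (simp add: scalar_prod_def[of "W *\<^sub>v c"] atLeast0LessThan del: index_mult_mat_vec)
    also have "\<dots> = (\<Sum>u\<in>pverts G. \<phi> c u * (\<Sum>v\<in>pverts G. of_bool ((u, v) \<in> parcs G) * \<phi> c v))"
      by (rule sum_vs)
    also have "\<dots> = (\<Sum>u\<in>pverts G. \<Sum>v\<in>pverts G. of_bool ((u, v) \<in> parcs G) * (\<phi> c u * \<phi> c v))"
      unfolding sum_distrib_left by (intro sum.cong refl) (simp only: mult_ac)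
    also have "\<dots> = (\<Sum>u\<in>pverts G. \<Sum>v\<in>pverts G. \<Sum>i<r. (c $ i)\<^sup>2 * of_bool ((u, v) \<in> parcs G \<inter> h i \<times> h i))"
    proof (intro sum.cong refl)
      fix u v
      show "of_bool ((u, v) \<in> parcs G) * (\<phi> c u * \<phi> c v) =
          (\<Sum>i<r. (c $ i)\<^sup>2 * of_bool ((u, v) \<in> parcs G \<inter> h i \<times> h i))"
        by (cases "(u, v) \<in> parcs G") (simp_all add: \<phi>2)
    qed
    also have "\<dots> = (\<Sum>p\<in>pverts G \<times> pverts G. \<Sum>i<r. (c $ i)\<^sup>2 * of_bool (p \<in> parcs G \<inter> h i \<times> h i))"
      by (subst sum.cartesian_product) (simp only: case_prod_unfold prod.collapse)
    also have "\<dots> = (\<Sum>i<r. \<Sum>p\<in>pverts G \<times> pverts G. (c $ i)\<^sup>2 * of_bool (p \<in> parcs G \<inter> h i \<times> h i))"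
      by (rule sum.swap)
    also have "\<dots> = (\<Sum>i<r. (c $ i)\<^sup>2 * real (card (parcs G \<inter> h i \<times> h i)))"
    proof (intro sum.cong refl)
      fix i assume "i \<in> {..<r}"
      then have "h i \<subseteq> pverts G" using sub hX by auto
      then have "(pverts G \<times> pverts G) \<inter> {p. p \<in> parcs G \<inter> h i \<times> h i} = parcs G \<inter> h i \<times> h i" by auto
      then show "(\<Sum>p\<in>pverts G \<times> pverts G. (c $ i)\<^sup>2 * of_bool (p \<in> parcs G \<inter> h i \<times> h i)) =
          (c $ i)\<^sup>2 * real (card (parcs G \<inter> h i \<times> h i))"
        using pair_finite_verts by (simp only: sum_distrib_left[symmetric]) (simp add: of_bool_def sum.If_cases del: Int_iff mem_Sigma_iff)
    qed
    finally show ?thesis .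
  qed
  have "r \<le> size (filter_mset (\<lambda>x. x \<ge> \<theta>) (proots (char_poly A)))"
  proof (rule card_eigenvalues_ge[OF A At W])
    fix c :: "real vec" assume c: "c \<in> carrier_vec r"
    show "W *\<^sub>v c \<noteq> 0\<^sub>v n" if "c \<noteq> 0\<^sub>v r"
    proof
      assume "W *\<^sub>v c = 0\<^sub>v n"
      then have "(\<Sum>i<r. (c $ i)\<^sup>2 * real (card (h i))) = 0" using norm[OF c] by simp
      then have "\<forall>i<r. (c $ i)\<^sup>2 * real (card (h i)) = 0" by (subst (asm) sum_nonneg_eq_0_iff) auto
      then have "c $ i = 0" if "i < r" for i using fin_h(2)[OF that] that by auto
      then have "c = 0\<^sub>v r" using c by (intro eq_vecI) auto
      then show False using that by simp
    qed
    show "\<theta> * ((W *\<^sub>v c) \<bullet> (W *\<^sub>v c)) \<le> (W *\<^sub>v c) \<bullet> (A *\<^sub>v (W *\<^sub>v c))"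
      unfolding norm[OF c] quad[OF c] sum_distrib_left
    proof (rule sum_mono)
      fix i assume "i \<in> {..<r}"
      then have "\<theta> * real (card (h i)) \<le> real (card (parcs G \<inter> h i \<times> h i))" using dense hX by auto
      from mult_left_mono[OF this, of "(c $ i)\<^sup>2"]
      show "\<theta> * ((c $ i)\<^sup>2 * real (card (h i))) \<le> (c $ i)\<^sup>2 * real (card (parcs G \<inter> h i \<times> h i))"
        by (simp add: mult_ac)
    qed
  qed
  then show ?thesis
    unfolding graph_eigenvalue_def graph_eigenvalues_def
    using m by (intro nth_descending_ge) (simp add: A_def r_def)
qed

section \<open>Spanning trees of symmetric digraphs\<close>

lemma undirected_edges_iff:
  assumes "sym (parcs G)" shows "{a, b} \<in> undirected_edges G \<longleftrightarrow> (a, b) \<in> parcs G"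
  using assms by (auto simp: undirected_edges_def doubleton_eq_iff dest: symD)

text \<open>
  Connectedness of a digraph is strong connectedness of its symmetric closure, whose arcs are the two
  orientations of the undirected edges.
\<close>

lemma connected_iff_joins:
  assumes "parcs G \<subseteq> pverts G \<times> pverts G"
  shows "connected (with_proj G) \<longleftrightarrow> pverts G \<noteq> {} \<and> joins (undirected_edges G) (pverts G)"
proof -
  define R where "R = {(a, b). {a, b} \<in> undirected_edges G}"
  have arcs: "parcs (mk_symmetric (with_proj G)) = R"
    by (auto simp: parcs_mk_symmetric R_def undirected_edges_def doubleton_eq_iff) blast
  have "R \<subseteq> pverts G \<times> pverts G"
    using assms by (auto simp: R_def undirected_edges_def doubleton_eq_iff)
  then have closed: "b \<in> pverts G" if "(a, b) \<in> R" for a b using that by blast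
  have "(u, v) \<in> rtrancl_on (pverts G) R \<longleftrightarrow> (u, v) \<in> R\<^sup>*" if "u \<in> pverts G" "v \<in> pverts G" for u v
  proof
    show "(u, v) \<in> rtrancl_on (pverts G) R" if "(u, v) \<in> R\<^sup>*"
      by (rule rtrancl_consistent_rtrancl_on[OF that \<open>u \<in> pverts G\<close> \<open>v \<in> pverts G\<close>]) (rule closed)
  qed (rule rtrancl_on_rtranclI)
  then show ?thesis
    unfolding connected_def strongly_connected_def reachable_def joins_def reach_def
    by (simp add: arcs R_def[symmetric])
qed

lemma pair_graph_arcs:
  assumes "pair_graph G"
  shows "sym (parcs G)" "irrefl (parcs G)" "parcs G \<subseteq> pverts G \<times> pverts G" "finite (pverts G)" "finite (parcs G)"
proof -
  interpret pair_graph G by fact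
  show "sym (parcs G)" using pair_sym_arcs by (simp add: symmetric_def)
  show "irrefl (parcs G)" using pair_no_loops by (force simp: irrefl_def)
  show "parcs G \<subseteq> pverts G \<times> pverts G" using in_arcsD1 in_arcsD2 by auto
  show "finite (pverts G)" "finite (parcs G)" by (rule pair_finite_verts pair_finite_arcs)+
qed

lemma undirected_edges_pairs_on:
  assumes "pair_graph G" shows "undirected_edges G \<subseteq> pairs_on (pverts G)"
  using pair_graph_arcs(2,3)[OF assms] by (fastforce simp: undirected_edges_def pairs_on_def irrefl_def)

lemma out_degree_card: "out_degree (with_proj G) v = card {a \<in> parcs G. fst a = v}"
  by (simp add: out_degree_def out_arcs_def)

lemma pcas_reach:
  "pcas u p v \<Longrightarrow> (\<And>a b. (a, b) \<in> set p \<Longrightarrow> {a, b} \<in> F) \<Longrightarrow> (u, v) \<in> reach F"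
proof (induction p arbitrary: u)
  case (Cons e p)
  have "(u, snd e) \<in> reach F" using Cons.prems by (cases e) (auto intro: reach_edge)
  moreover have "(snd e, v) \<in> reach F" using Cons by auto
  ultimately show ?case by (rule reach_trans)
qed simp

lemma pcas_arc_verts:
  "pcas u p v \<Longrightarrow> (a, b) \<in> set p \<Longrightarrow> a \<in> set (pawalk_verts u p) \<and> b \<in> set (pawalk_verts u p)"
proof (induction p arbitrary: u)
  case (Cons e p)
  have "snd e \<in> set (pawalk_verts (snd e) p)" by (cases p) (use Cons.prems in auto)
  then show ?case using Cons by auto
qed simp

lemma pcas_last: "pcas u p v \<Longrightarrow> v \<in> set (pawalk_verts u p)"
  by (induction p arbitrary: u) auto

definition edge_subgraph :: "'a pair_pre_digraph \<Rightarrow> 'a set set \<Rightarrow> 'a pair_pre_digraph" where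
  "edge_subgraph G T = G\<lparr>parcs := {(u, v). {u, v} \<in> T}\<rparr>"

lemma edge_subgraph_simps [simp]:
  "pverts (edge_subgraph G T) = pverts G" "parcs (edge_subgraph G T) = {(u, v). {u, v} \<in> T}"
  by (simp_all add: edge_subgraph_def)

lemma undirected_edges_edge_subgraph:
  assumes "T \<subseteq> pairs_on V" shows "undirected_edges (edge_subgraph G T) = T"
proof
  show "T \<subseteq> undirected_edges (edge_subgraph G T)"
  proof
    fix e assume e: "e \<in> T"
    then have "e \<in> pairs_on V" using assms by blast
    then obtain a b where "e = {a, b}" by (rule pairs_onE)
    then show "e \<in> undirected_edges (edge_subgraph G T)" using e by (auto simp: undirected_edges_def)
  qed
qed (auto simp: undirected_edges_def)

text \<open>
  A cycle of length at least 3 through the arc \<open>(u, w)\<close> returns from \<open>w\<close> to \<open>u\<close> without using the edge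
  \<open>{u, w}\<close> again, so that edge would be redundant in the forest.
\<close>

lemma edge_subgraph_undirected_tree:
  assumes fin: "finite (pverts G)" and ne: "pverts G \<noteq> {}" and T: "T \<subseteq> pairs_on (pverts G)"
    and joins: "joins T (pverts G)" and forest: "forest_edges T"
  shows "undirected_tree (edge_subgraph G T)"
  unfolding undirected_tree_def
proof (intro conjI notI)
  let ?H = "edge_subgraph G T"
  have sub: "parcs ?H \<subseteq> pverts G \<times> pverts G"
    using T by (auto simp: pairs_on_def doubleton_eq_iff)
  then have finT: "finite (parcs ?H)" using fin finite_subset by blast
  have "a \<noteq> b" "a \<in> pverts G" "b \<in> pverts G" if "{a, b} \<in> T" for a b
    using T that by (auto simp: pairs_on_def doubleton_eq_iff)
  then have arc: "fst e \<in> pverts ?H" "snd e \<in> pverts ?H" "fst e \<noteq> snd e" if "e \<in> parcs ?H" for e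
    using that by (cases e; simp)+
  show "pair_graph ?H"
  proof unfold_locales
    show "symmetric (with_proj ?H)" by (auto simp: symmetric_def sym_def insert_commute)
  qed (use fin finT arc in simp_all)
  show "connected (with_proj ?H)"
    using connected_iff_joins[of ?H] sub ne joins undirected_edges_edge_subgraph[OF T, of G] by simp
  assume "\<exists>p. pre_digraph.cycle (with_proj ?H) p \<and> 3 \<le> length p"
  then obtain p u where p: "pcas u p u" "distinct (tl (pawalk_verts u p))" "3 \<le> length p" "set p \<subseteq> parcs ?H"
    by (auto simp: pre_digraph.cycle_def pre_digraph.awalk_def cas_with_proj_eq awalk_verts_with_proj_eq)
  then obtain w x q where q: "p = (u, w) # (w, x) # q"
    by (cases p rule: list.exhaust; cases "tl p") (auto simp: Suc_le_eq)
  have qx: "pcas x q u" "distinct (w # pawalk_verts x q)" "q \<noteq> []" using p q by auto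
  \<comment> \<open>The walk leaves \<open>w\<close> by an arc to \<open>x\<close>; if \<open>x\<close> were \<open>u\<close>, the nonempty rest would visit \<open>u\<close> twice.\<close>
  have x_u: "x \<noteq> u"
  proof
    assume "x = u"
    obtain e q' where e: "q = e # q'" using qx(3) by (cases q) auto
    then have "u \<in> set (pawalk_verts (snd e) q')" "fst e = u" using qx(1) pcas_last \<open>x = u\<close> by auto
    then show False using qx(2) e by auto
  qed
  \<comment> \<open>The way back from \<open>w\<close> to \<open>u\<close> avoids \<open>{u, w}\<close>: its first edge misses \<open>u\<close>, all later ones miss \<open>w\<close>.\<close>
  have edges: "{u, w} \<in> T" "{w, x} \<in> T" using p(4) q by auto
  have "(w, x) \<in> reach (T - {{u, w}})"
    using edges x_u by (intro reach_edge) (auto simp: doubleton_eq_iff)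
  moreover have "(x, u) \<in> reach (T - {{u, w}})"
  proof (rule pcas_reach[OF qx(1)])
    fix a b assume ab: "(a, b) \<in> set q"
    then have "a \<noteq> w" "b \<noteq> w" using pcas_arc_verts[OF qx(1) ab] qx(2) by auto
    then show "{a, b} \<in> T - {{u, w}}" using ab p(4) q by (auto simp: doubleton_eq_iff)
  qed
  ultimately have "(u, w) \<in> reach (T - {{u, w}})" by (meson reach_sym reach_trans)
  moreover have "u \<noteq> w" using edges T by (auto simp: pairs_on_def)
  ultimately show False using forest edges by (auto simp: forest_edges_def)
qed

lemma out_degree_edge_subgraph:
  assumes "finite T" shows "out_degree (with_proj (edge_subgraph G T)) v \<le> edge_degree T v"
  unfolding out_degree_card edge_degree_def
proof (rule card_inj_on_le)
  show "inj_on (\<lambda>(a, b). {a, b}) {a \<in> parcs (edge_subgraph G T). fst a = v}"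
    by (auto simp: inj_on_def doubleton_eq_iff)
qed (use assms in auto)

lemma has_spanning_k_tree_if_tough:
  assumes G: "pair_graph G" and con: "connected (with_proj G)" and k: "k \<ge> 2"
    and tough: "\<And>S. S \<subseteq> pverts G \<Longrightarrow> S \<noteq> {} \<Longrightarrow>
      card (comps (avoid (undirected_edges G) S) (pverts G - S)) \<le> (k - 2) * card S + 2"
  shows "has_spanning_k_tree k G"
proof -
  note arcs = pair_graph_arcs[OF G]
  have E: "undirected_edges G \<subseteq> pairs_on (pverts G)" using G by (rule undirected_edges_pairs_on)
  have ne: "pverts G \<noteq> {}" and joins: "joins (undirected_edges G) (pverts G)"
    using con connected_iff_joins[OF arcs(3)] by auto
  obtain T where T: "T \<subseteq> undirected_edges G" "joins T (pverts G)" "card T + 1 \<le> card (pverts G)"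
    and edge_degree: "\<And>v. v \<in> pverts G \<Longrightarrow> edge_degree T v \<le> k"
    using spanning_tree_of_bounded_degree[OF arcs(4) ne E joins k tough] by blast
  have TV: "T \<subseteq> pairs_on (pverts G)" using T(1) E by blast
  then have fT: "finite T" using finite_pairs_on[OF arcs(4)] finite_subset by blast
  let ?H = "edge_subgraph G T"
  have tree: "undirected_tree ?H"
    using arcs(4) ne TV T(2) tree_forest[OF arcs(4) TV T(2,3)] by (rule edge_subgraph_undirected_tree)
  have sub: "parcs ?H \<subseteq> parcs G" using T(1) undirected_edges_iff[OF arcs(1)] by auto
  have "wf_digraph (with_proj ?H)" "wf_digraph (with_proj G)"
    using sub arcs(3) by (auto simp: wf_digraph_def)
  then have "spanning (with_proj ?H) (with_proj G)"
    using sub by (auto simp: spanning_def subgraph_def compatible_def)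
  moreover have "k_tree k ?H"
    unfolding k_tree_def
  proof (intro conjI ballI)
    fix v assume "v \<in> pverts ?H"
    then have "edge_degree T v \<le> k" by (simp add: edge_degree)
    then show "out_degree (with_proj ?H) v \<le> k" using out_degree_edge_subgraph[OF fT, of G v] by (rule le_trans[rotated])
  qed (rule tree)
  ultimately show ?thesis by (auto simp: has_spanning_k_tree_def)
qed

section \<open>Arcs leaving the components\<close>

definition leaving :: "'a pair_pre_digraph \<Rightarrow> 'a set \<Rightarrow> ('a \<times> 'a) set" where
  "leaving G X = {a \<in> parcs G. fst a \<in> X \<and> snd a \<notin> X}"

text \<open>
  Without the edges that leave \<open>X\<close>, no vertex outside \<open>X\<close> is reachable from \<open>X\<close>.
\<close>

lemma cut_disconnects:
  assumes G: "pair_graph G" and X: "X \<subseteq> pverts G" "X \<noteq> {}" "X \<noteq> pverts G"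
  shows "\<not> connected (with_proj (delete_edges G ((\<lambda>(a, b). {a, b}) ` leaving G X)))" (is "\<not> connected (with_proj ?H)")
proof
  note arcs = pair_graph_arcs[OF G]
  assume con: "connected (with_proj ?H)"
  have sub: "parcs ?H \<subseteq> parcs G" "pverts ?H = pverts G" by (auto simp: delete_edges_def)
  then have "parcs ?H \<subseteq> pverts ?H \<times> pverts ?H" using arcs(3) by auto
  then have joins: "joins (undirected_edges ?H) (pverts G)" using con connected_iff_joins sub(2) by metis
  obtain x y where xy: "x \<in> X" "y \<in> pverts G" "y \<notin> X" using X by blast
  have "reach (undirected_edges ?H) `` {x} \<subseteq> X"
  proof (rule reach_closed)
    fix a b assume ab: "{a, b} \<in> undirected_edges ?H" "a \<in> X"
    then have "{a, b} \<notin> (\<lambda>(a, b). {a, b}) ` leaving G X" "(a, b) \<in> parcs G \<or> (b, a) \<in> parcs G"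
      by (auto simp: undirected_edges_def delete_edges_def doubleton_eq_iff insert_commute)
    then show "b \<in> X" using ab(2) arcs(1) by (auto simp: leaving_def image_iff dest: symD)
  qed (use xy in simp)
  moreover have "(x, y) \<in> reach (undirected_edges ?H)" using joins xy X(1) by (auto simp: joins_def)
  ultimately show False using xy by auto
qed

lemma edge_connectivity_le_leaving:
  assumes G: "pair_graph G" and X: "X \<subseteq> pverts G" "X \<noteq> {}" "X \<noteq> pverts G"
  shows "edge_connectivity G \<le> card (leaving G X)"
proof (cases "card (pverts G) \<le> 1")
  case False
  let ?F = "(\<lambda>(a, b). {a, b}) ` leaving G X"
  have fin: "finite (leaving G X)" using pair_graph_arcs(5)[OF G] by (simp add: leaving_def)
  have "?F \<subseteq> undirected_edges G" by (auto simp: leaving_def undirected_edges_def)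
  then have "edge_connectivity G \<le> card ?F"
    unfolding edge_connectivity_def using False cut_disconnects[OF G X] by (auto intro!: Least_le)
  also have "\<dots> \<le> card (leaving G X)" using fin by (rule card_image_le)
  finally show ?thesis .
qed (simp add: edge_connectivity_def)

lemma leaving_nonempty:
  assumes G: "pair_graph G" and con: "connected (with_proj G)"
    and X: "X \<subseteq> pverts G" "X \<noteq> {}" "X \<noteq> pverts G"
  shows "leaving G X \<noteq> {}"
proof
  assume "leaving G X = {}"
  moreover have "delete_edges G {} = G" by (simp add: delete_edges_def)
  ultimately show False using cut_disconnects[OF G X] con by simp
qed

lemma card_arcs_from:
  assumes G: "pair_graph G" and reg: "regular_graph d G" and X: "X \<subseteq> pverts G"
  shows "card {a \<in> parcs G. fst a \<in> X} = d * card X"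
proof -
  note arcs = pair_graph_arcs[OF G]
  have finX: "finite X" using X arcs(4) finite_subset by blast
  have "{a \<in> parcs G. fst a \<in> X} = (\<Union>v\<in>X. {a \<in> parcs G. fst a = v})" by auto
  also have "card \<dots> = (\<Sum>v\<in>X. card {a \<in> parcs G. fst a = v})"
    using finX arcs(5) by (intro card_UN_disjoint) auto
  also have "\<dots> = (\<Sum>v\<in>X. d)"
    using reg X by (intro sum.cong) (auto simp: regular_graph_def out_degree_card[symmetric])
  finally show ?thesis by (simp add: mult.commute)
qed

lemma card_arcs_to:
  assumes G: "pair_graph G" and reg: "regular_graph d G" and X: "X \<subseteq> pverts G"
  shows "card {a \<in> parcs G. snd a \<in> X} = d * card X"
proof -
  have "{a \<in> parcs G. snd a \<in> X} = prod.swap ` {a \<in> parcs G. fst a \<in> X}"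
    using pair_graph_arcs(1)[OF G] by (auto simp: image_iff dest: symD)
  then have "card {a \<in> parcs G. snd a \<in> X} = card {a \<in> parcs G. fst a \<in> X}"
    by (simp add: card_image inj_on_def)
  then show ?thesis using card_arcs_from[OF assms] by simp
qed

lemma card_inside_plus_leaving:
  assumes G: "pair_graph G" and reg: "regular_graph d G" and X: "X \<subseteq> pverts G"
  shows "card (parcs G \<inter> X \<times> X) + card (leaving G X) = d * card X"
proof -
  have fin: "finite (parcs G)" by (rule pair_graph_arcs(5)[OF G])
  have "{a \<in> parcs G. fst a \<in> X} = (parcs G \<inter> X \<times> X) \<union> leaving G X" by (auto simp: leaving_def)
  also have "card \<dots> = card (parcs G \<inter> X \<times> X) + card (leaving G X)"
    using fin by (intro card_Un_disjoint) (auto simp: leaving_def)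
  finally show ?thesis using card_arcs_from[OF assms] by simp
qed

text \<open>
  If \<open>X\<close> had \<open>n\<close> vertices with \<open>1 \<le> n \<le> d\<close>, at most \<open>n (n - 1)\<close> of its \<open>d n\<close> outgoing arcs would stay
  inside, and \<open>d n - n (n - 1) = d + (d - n) (n - 1) \<ge> d\<close> would leave.
\<close>

lemma few_leaving_imp_large:
  assumes G: "pair_graph G" and reg: "regular_graph d G" and X: "X \<subseteq> pverts G" "X \<noteq> {}"
    and few: "card (leaving G X) < d"
  shows "d + 1 \<le> card X"
proof (rule ccontr)
  note arcs = pair_graph_arcs[OF G]
  assume "\<not> d + 1 \<le> card X"
  then have le: "card X \<le> d" by simp
  have finX: "finite X" using X arcs(4) finite_subset by blast
  then have pos: "1 \<le> card X" using X by (simp add: Suc_leI card_gt_0_iff)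
  have "parcs G \<inter> X \<times> X \<subseteq> X \<times> X - (\<lambda>v. (v, v)) ` X" using arcs(2) by (auto simp: irrefl_def)
  then have "card (parcs G \<inter> X \<times> X) \<le> card (X \<times> X - (\<lambda>v. (v, v)) ` X)"
    using finX by (intro card_mono) auto
  also have "\<dots> = card X * card X - card X"
    using finX by (subst card_Diff_subset) (auto simp: card_cartesian_product card_image inj_on_def)
  finally have "d * card X \<le> card X * card X - card X + card (leaving G X)"
    using card_inside_plus_leaving[OF G reg X(1)] by linarith
  moreover have "card X \<le> card X * card X" using pos by simp
  ultimately have "d * card X + card X < card X * card X + d" using few by linarith
  then have "int (d * card X + card X) < int (card X * card X + d)" by (simp only: of_nat_less_iff)
  then have "(int d - int (card X)) * (int (card X) - 1) < 0" by (simp add: algebra_simps)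
  moreover have "(int d - int (card X)) * (int (card X) - 1) \<ge> 0" using le pos by (intro mult_nonneg_nonneg) auto
  ultimately show False by simp
qed

lemma comps_avoid_props:
  assumes E: "E \<subseteq> pairs_on V" and X: "X \<in> comps (avoid E S) (V - S)"
  shows "X \<subseteq> V - S" "X \<noteq> {}"
    and "Y \<in> comps (avoid E S) (V - S) \<Longrightarrow> X \<noteq> Y \<Longrightarrow> X \<inter> Y = {}"
    and "u \<in> X \<Longrightarrow> v \<in> V - S \<Longrightarrow> {u, v} \<in> E \<Longrightarrow> v \<in> X"
proof -
  obtain x where x: "x \<in> V - S" "X = reach (avoid E S) `` {x}" using X by (auto simp: comps_def)
  show "X \<subseteq> V - S" using reach_avoid_class[OF E x(1)] x(2) by simp
  then have "u \<in> V - S" if "u \<in> X" for u using that by blast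
  have "x \<in> X" by (simp add: x(2))
  then show "X \<noteq> {}" by blast
  show "X \<inter> Y = {}" if Y: "Y \<in> comps (avoid E S) (V - S)" and "X \<noteq> Y"
  proof (rule ccontr)
    obtain y where y: "Y = reach (avoid E S) `` {y}" using Y by (auto simp: comps_def)
    assume "X \<inter> Y \<noteq> {}"
    then obtain z where "(x, z) \<in> reach (avoid E S)" "(y, z) \<in> reach (avoid E S)" by (auto simp: x(2) y)
    then have "X = Y" unfolding x(2) y by (metis reach_class_eq)
    then show False using \<open>X \<noteq> Y\<close> by simp
  qed
  show "v \<in> X" if "u \<in> X" "v \<in> V - S" "{u, v} \<in> E"
  proof -
    have "u \<in> V - S" using \<open>X \<subseteq> V - S\<close> that by blast
    then have "{u, v} \<in> avoid E S" using that by (auto simp: avoid_def)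
    then show ?thesis using that(1) unfolding x(2) by (auto intro: reach_trans reach_edge)
  qed
qed

text \<open>
  The arcs leaving the components all end in \<open>S\<close>, so their total is at most \<open>d * card S\<close>. Among the
  components, those in \<open>\<R>\<close> account for at least as many arcs each as the edge connectivity, and the others for at least
  \<open>d / (k - 2)\<close>. Since there are at least \<open>(k - 2) * card S + 3\<close> components, comparing the totals bounds the number of
  components in \<open>\<R>\<close> from below. The degree \<open>d\<close> is positive because every component sends an arc to \<open>S\<close>.
\<close>

lemma many_components_with_few_leaving:
  fixes k d :: nat
  assumes G: "pair_graph G" and con: "connected (with_proj G)" and reg: "regular_graph d G" and k: "k \<ge> 3"
    and S: "S \<subseteq> pverts G" "S \<noteq> {}"
    and many: "(k - 2) * card S + 3 \<le> card (comps (avoid (undirected_edges G) S) (pverts G - S))"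
  obtains \<R> where "\<R> \<subseteq> comps (avoid (undirected_edges G) S) (pverts G - S)" "finite \<R>" "0 < d"
    "\<And>X. X \<in> \<R> \<Longrightarrow> (k - 2) * card (leaving G X) < d"
    "3 * int d \<le> int (card \<R>) * (int d - (int k - 2) * int (edge_connectivity G))"
proof -
  note arcs = pair_graph_arcs[OF G]
  define E where "E = undirected_edges G"
  define V where "V = pverts G"
  define \<C> where "\<C> = comps (avoid E S) (V - S)"
  define t where "t X = card (leaving G X)" for X
  define \<kappa> where "\<kappa> = edge_connectivity G"
  define \<R> where "\<R> = {X \<in> \<C>. (k - 2) * t X < d}"
  have E: "E \<subseteq> pairs_on V" unfolding E_def V_def using G by (rule undirected_edges_pairs_on)
  have finC: "finite \<C>" using arcs(4) by (simp add: \<C>_def comps_def V_def)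
  note props = comps_avoid_props[OF E, of _ S, folded \<C>_def]
  have proper: "X \<subseteq> pverts G" "X \<noteq> {}" "X \<noteq> pverts G" if "X \<in> \<C>" for X
    using props(1,2)[OF that] S by (auto simp: V_def)
  have t_ge: "\<kappa> \<le> t X" if "X \<in> \<C>" for X
    unfolding \<kappa>_def t_def by (rule edge_connectivity_le_leaving[OF G proper[OF that]])
  have fin_leaving: "finite (leaving G X)" for X using arcs(5) by (simp add: leaving_def)
  have t_pos: "0 < t X" if "X \<in> \<C>" for X
    using leaving_nonempty[OF G con proper[OF that]] fin_leaving by (simp add: t_def card_gt_0_iff)
  have into_S: "leaving G X \<subseteq> {a \<in> parcs G. snd a \<in> S}" if X: "X \<in> \<C>" for X
  proof
    fix a assume "a \<in> leaving G X"
    then have a: "(fst a, snd a) \<in> parcs G" "fst a \<in> X" "snd a \<notin> X" by (auto simp: leaving_def)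
    then have "{fst a, snd a} \<in> E" "snd a \<in> V"
      using arcs(1,3) undirected_edges_iff[OF arcs(1)] by (auto simp: E_def V_def)
    then show "a \<in> {a \<in> parcs G. snd a \<in> S}" using props(4)[OF X a(2), of "snd a"] a by auto
  qed
  have "(\<Sum>X\<in>\<C>. t X) = card (\<Union>X\<in>\<C>. leaving G X)"
    unfolding t_def
  proof (rule card_UN_disjoint[symmetric])
    show "\<forall>X\<in>\<C>. \<forall>Y\<in>\<C>. X \<noteq> Y \<longrightarrow> leaving G X \<inter> leaving G Y = {}"
      using props(3) by (fastforce simp: leaving_def)
  qed (use finC fin_leaving in auto)
  also have "\<dots> \<le> card {a \<in> parcs G. snd a \<in> S}"
    using into_S arcs(5) by (intro card_mono) auto
  also have "\<dots> = d * card S" using card_arcs_to[OF G reg S(1)] .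
  finally have sum_t: "(\<Sum>X\<in>\<C>. t X) \<le> d * card S" .
  have RC: "\<R> \<subseteq> \<C>" by (auto simp: \<R>_def)
  then have finR: "finite \<R>" using finC finite_subset by blast
  have "card \<C> = card \<R> + card (\<C> - \<R>)"
    using card_Diff_subset[OF finR RC] card_mono[OF finC RC] by simp
  moreover have "card \<R> * ((k - 2) * \<kappa>) + card (\<C> - \<R>) * d \<le> (k - 2) * (d * card S)"
  proof -
    have "card \<R> * ((k - 2) * \<kappa>) \<le> (\<Sum>X\<in>\<R>. (k - 2) * t X)"
      using sum_bounded_below[of \<R> "(k - 2) * \<kappa>" "\<lambda>X. (k - 2) * t X"] t_ge RC by auto
    moreover have "card (\<C> - \<R>) * d \<le> (\<Sum>X\<in>\<C> - \<R>. (k - 2) * t X)"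
    proof -
      have "d \<le> (k - 2) * t X" if "X \<in> \<C> - \<R>" for X using that by (auto simp: \<R>_def)
      then show ?thesis using sum_bounded_below[of "\<C> - \<R>" d "\<lambda>X. (k - 2) * t X"] by simp
    qed
    moreover have "(\<Sum>X\<in>\<R>. (k - 2) * t X) + (\<Sum>X\<in>\<C> - \<R>. (k - 2) * t X) = (k - 2) * (\<Sum>X\<in>\<C>. t X)"
      using sum.subset_diff[OF RC finC, of "\<lambda>X. (k - 2) * t X"] by (simp add: sum_distrib_left)
    moreover have "(k - 2) * (\<Sum>X\<in>\<C>. t X) \<le> (k - 2) * (d * card S)" using sum_t by simp
    ultimately show ?thesis by linarith
  qed
  moreover have "((k - 2) * card S + 3) * d \<le> card \<C> * d"
    using many by (intro mult_right_mono) (simp_all add: \<C>_def E_def V_def)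
  ultimately have "3 * d + card \<R> * ((k - 2) * \<kappa>) \<le> card \<R> * d"
    by (simp add: algebra_simps)
  moreover define c where "c = k - 2"
  ultimately have "int (3 * d + card \<R> * (c * \<kappa>)) \<le> int (card \<R> * d)" by (simp only: of_nat_le_iff)
  then have "3 * int d \<le> int (card \<R>) * (int d - int c * int \<kappa>)" by (simp add: algebra_simps)
  moreover have "int c = int k - 2" using k by (simp add: c_def)
  ultimately have "3 * int d \<le> int (card \<R>) * (int d - (int k - 2) * int \<kappa>)" by simp
  moreover have "0 < d"
  proof (rule ccontr)
    assume "\<not> 0 < d"
    then have "\<forall>X\<in>\<C>. t X = 0" using sum_t finC by simp
    then have "\<C> = {}" using t_pos by fastforce
    then show False using many by (simp add: \<C>_def E_def V_def)
  qed
  moreover have "(k - 2) * card (leaving G X) < d" if "X \<in> \<R>" for X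
    using that by (simp add: \<R>_def t_def)
  ultimately show ?thesis
    using that RC finR unfolding \<C>_def E_def V_def \<kappa>_def by blast
qed

theorem theorem1p15:
  fixes G :: "'a pair_pre_digraph" and k d :: nat and l :: int
  assumes "k \<ge> 3"
    and "pair_graph G" and "connected (with_proj G)" and "regular_graph d G"
    and "l = int d - (int k - 2) * int (edge_connectivity G)"
  shows "(l \<le> 0 \<longrightarrow> has_spanning_k_tree k G) \<and>
    (l > 0 \<and>
      graph_eigenvalue G (nat \<lceil>3 * real d / real_of_int l\<rceil>)
        < real d - real d / ((real k - 2) * (real d + 1))
      \<longrightarrow> has_spanning_k_tree k G)"
proof (cases "has_spanning_k_tree k G")
  case False
  note k = assms(1) and G = assms(2) and con = assms(3) and reg = assms(4)
  define \<theta> where "\<theta> = real d - real d / ((real k - 2) * (real d + 1))"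
  let ?\<C> = "\<lambda>S. comps (avoid (undirected_edges G) S) (pverts G - S)"
  have "\<exists>S. S \<subseteq> pverts G \<and> S \<noteq> {} \<and> \<not> card (?\<C> S) \<le> (k - 2) * card S + 2"
  proof (rule ccontr)
    assume "\<not> ?thesis"
    then have "has_spanning_k_tree k G"
      using k by (intro has_spanning_k_tree_if_tough[OF G con]) auto
    then show False using False by simp
  qed
  then obtain S where S: "S \<subseteq> pverts G" "S \<noteq> {}" and "\<not> card (?\<C> S) \<le> (k - 2) * card S + 2" by blast
  then have many: "(k - 2) * card S + 3 \<le> card (?\<C> S)" by simp
  obtain \<R> where \<R>: "\<R> \<subseteq> ?\<C> S" "finite \<R>" "0 < d"
    and few: "\<And>X. X \<in> \<R> \<Longrightarrow> (k - 2) * card (leaving G X) < d"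
    and card_R: "3 * int d \<le> int (card \<R>) * l"
    using many_components_with_few_leaving[OF G con reg k S many] unfolding assms(5) by metis
  have "0 < int (card \<R>) * l" using card_R \<R>(3) by linarith
  then have l: "l > 0" by (simp add: zero_less_mult_iff)
  define m where "m = nat \<lceil>3 * real d / real_of_int l\<rceil>"
  have m1: "1 \<le> m"
  proof -
    have "0 < 3 * real d / real_of_int l" using l \<R>(3) by simp
    then show ?thesis unfolding m_def by linarith
  qed
  have mR: "m \<le> card \<R>"
  proof -
    have "3 * real d \<le> real (card \<R>) * real_of_int l"
      using card_R by (metis (no_types, lifting) of_int_le_iff of_int_mult of_int_numeral of_int_of_nat_eq)
    then have "3 * real d / real_of_int l \<le> real (card \<R>)" using l by (simp add: divide_le_eq)
    then have "\<lceil>3 * real d / real_of_int l\<rceil> \<le> int (card \<R>)" by (simp add: ceiling_le_iff)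
    then show ?thesis unfolding m_def by linarith
  qed
  note props = comps_avoid_props[OF undirected_edges_pairs_on[OF G], OF subsetD[OF \<R>(1)]]
  have RV: "X \<subseteq> pverts G" if "X \<in> \<R>" for X using props(1)[OF that] by blast
  have "\<theta> \<le> graph_eigenvalue G m"
  proof (rule graph_eigenvalue_ge[OF G \<R>(2) m1 mR RV props(2)])
    show "X \<inter> Y = {}" if "X \<in> \<R>" "Y \<in> \<R>" "X \<noteq> Y" for X Y
      using props(3)[OF that(1) subsetD[OF \<R>(1) that(2)] that(3)] .
    show "(u, v) \<notin> parcs G" if XY: "X \<in> \<R>" "Y \<in> \<R>" "X \<noteq> Y" "u \<in> X" "v \<in> Y" for X Y u v
    proof
      assume "(u, v) \<in> parcs G"
      then have "{u, v} \<in> undirected_edges G" by (auto simp: undirected_edges_def)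
      then have "v \<in> X" using props(4)[OF XY(1,4), of v] props(1)[OF XY(2)] XY(5) by blast
      then show False using props(3)[OF XY(1) subsetD[OF \<R>(1) XY(2)] XY(3)] XY(5) by blast
    qed
    show "\<theta> * real (card X) \<le> real (card (parcs G \<inter> X \<times> X))" if X: "X \<in> \<R>" for X
    proof -
      define t where "t = card (leaving G X)"
      have kt: "real ((k - 2) * t) < real d" using few[OF X] unfolding t_def by (simp only: of_nat_less_iff)
      have "1 * t \<le> (k - 2) * t" using k by (intro mult_right_mono) auto
      \<comment> \<open>For \<open>k = 3\<close> it is the strict bound on \<open>t\<close> that rules out components with 1 or \<open>d\<close> vertices.\<close>
      then have "t < d" using few[OF X] unfolding t_def by linarith
      then have large: "d + 1 \<le> card X"
        using few_leaving_imp_large[OF G reg RV[OF X] props(2)[OF X]] by (simp add: t_def)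
      have "real (card (parcs G \<inter> X \<times> X) + t) = real (d * card X)"
        using card_inside_plus_leaving[OF G reg RV[OF X]] by (simp only: t_def)
      then have inside: "real (card (parcs G \<inter> X \<times> X)) = real d * real (card X) - real t" by simp
      have k2: "real k - 2 > 0" using k by simp
      have "real t \<le> real d / (real k - 2)"
        using kt k k2 by (simp add: le_divide_eq of_nat_diff mult.commute)
      also have "\<dots> = real d / ((real k - 2) * (real d + 1)) * (real d + 1)"
      proof -
        have "real d / a = real d / (a * b) * b" if "b > 0" for a b :: real using that by simp
        then show ?thesis by simp
      qed
      also have "\<dots> \<le> real d / ((real k - 2) * (real d + 1)) * real (card X)"
        using large k2 by (intro mult_left_mono) auto
      finally show ?thesis unfolding inside \<theta>_def by (simp add: left_diff_distrib)
    qed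
  qed
  then show ?thesis using l unfolding \<theta>_def m_def by auto
qed simp

end
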